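(* Let $H^2_{\beta}$ be a weighted Hardy space of polynomial growth, and let $B(z)$ be a finite Blaschke product of order $m$ on $\mathbb{D}$. Then the multiplication operator $M_B$ on $H^2_\beta$ is similar to the direct sum $\bigoplus_{1}^{m}M_z$ of $m$ copies of $M_z$ acting on the direct sum $\bigoplus_1^m H^2_\beta$ of $m$ copies of $H^2_\beta$.
   Context: $\mathbb{D}$ is the open unit disk in $\mathbb{C}$. Let $w=\{w_k\}_{k\ge1}$ be positive numbers with $w_k\to1$; put $\beta_0=1$, $\beta_k=\prod_{j=1}^k w_j$. The weighted Hardy space $H^2_\beta$ induced by $w$ is the Hilbert space of functions $f(z)=\sum_{k\ge0}\widehat f(k)z^k$ analytic on $\mathbb{D}$ with $\|f\|^2=\sum_{k\ge0}|\widehat f(k)|^2\beta_k^2<\infty$. It is of polynomial growth if $\sup_k (k+1)|w_k-1|<\infty$. $M_f$ denotes multiplication by $f$; it is bounded on $H^2_\beta$ for every $f$ analytic on a neighborhood of $\overline{\mathbb{D}}$. A finite Blaschke product of order $m\ge1$ is $B(z)=e^{i\theta}\prod_{j=1}^m\frac{z_j-z}{1-\overline{z_j}z}$ with $\theta\in\mathbb{R}$ and $z_1,\dots,z_m\in\mathbb{D}$ (not necessarily distinct). Bounded operators $A$ on $\mathcal{H}$ and $B'$ on $\mathcal{K}$ are similar if $XA=B'X$ for some bounded invertible $X:\mathcal{H}\to\mathcal{K}$. *)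

theory Defs
  imports "HOL-Complex_Analysis.Complex_Analysis"
begin

section \<open>Normed spaces with an explicit carrier, and similarity of operators\<close>

text \<open>The spaces below depend on a weight sequence and on a number of copies, so they are not
  types.  A complex normed space is therefore given by its carrier, its operations and its norm.
  The Hilbert space structure enters boundedness and similarity only through the norm.\<close>

record 'a cspace =
  elems :: "'a set"
  vplus :: "'a \<Rightarrow> 'a \<Rightarrow> 'a"
  vscale :: "complex \<Rightarrow> 'a \<Rightarrow> 'a"
  vnorm :: "'a \<Rightarrow> real"

definition bounded_operator :: "'a cspace \<Rightarrow> 'b cspace \<Rightarrow> ('a \<Rightarrow> 'b) \<Rightarrow> bool" where
  "bounded_operator H K T \<longleftrightarrow>
     T \<in> elems H \<rightarrow> elems K \<and>
     (\<forall>x\<in>elems H. \<forall>y\<in>elems H. T (vplus H x y) = vplus K (T x) (T y)) \<and>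
     (\<forall>c. \<forall>x\<in>elems H. T (vscale H c x) = vscale K c (T x)) \<and>
     (\<exists>C. \<forall>x\<in>elems H. vnorm K (T x) \<le> C * vnorm H x)"

definition bounded_invertible :: "'a cspace \<Rightarrow> 'b cspace \<Rightarrow> ('a \<Rightarrow> 'b) \<Rightarrow> bool" where
  "bounded_invertible H K X \<longleftrightarrow>
     bounded_operator H K X \<and>
     (\<exists>Y. bounded_operator K H Y \<and>
          (\<forall>x\<in>elems H. Y (X x) = x) \<and> (\<forall>y\<in>elems K. X (Y y) = y))"

definition similar_operators ::
    "'a cspace \<Rightarrow> ('a \<Rightarrow> 'a) \<Rightarrow> 'b cspace \<Rightarrow> ('b \<Rightarrow> 'b) \<Rightarrow> bool" where
  "similar_operators H A K A' \<longleftrightarrow>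
     bounded_operator H H A \<and> bounded_operator K K A' \<and>
     (\<exists>X. bounded_invertible H K X \<and> (\<forall>x\<in>elems H. X (A x) = A' (X x)))"

text \<open>The direct sum of a finite family carries the \<open>\<ell>\<^sup>2\<close> norm.  Its elements are
  functions on the index set, extended by \<^const>\<open>undefined\<close> outside it, so that equality of
  elements is equality of components.\<close>

definition direct_sum :: "'i set \<Rightarrow> ('i \<Rightarrow> 'a cspace) \<Rightarrow> ('i \<Rightarrow> 'a) cspace" where
  "direct_sum I H =
     \<lparr> elems = (\<Pi>\<^sub>E i\<in>I. elems (H i)),
       vplus = (\<lambda>F G. \<lambda>i\<in>I. vplus (H i) (F i) (G i)),
       vscale = (\<lambda>c F. \<lambda>i\<in>I. vscale (H i) c (F i)),
       vnorm = (\<lambda>F. sqrt (\<Sum>i\<in>I. (vnorm (H i) (F i))\<^sup>2)) \<rparr>"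

definition direct_sum_operator :: "'i set \<Rightarrow> ('i \<Rightarrow> 'a \<Rightarrow> 'a) \<Rightarrow> ('i \<Rightarrow> 'a) \<Rightarrow> ('i \<Rightarrow> 'a)" where
  "direct_sum_operator I A F = (\<lambda>i\<in>I. A i (F i))"

section \<open>Weighted Hardy spaces\<close>

text \<open>Weights are indexed from 1; the value \<open>w 0\<close> plays no role.\<close>

definition weight_sequence :: "(nat \<Rightarrow> real) \<Rightarrow> bool" where
  "weight_sequence w \<longleftrightarrow> (\<forall>k\<ge>1. w k > 0) \<and> w \<longlonglongrightarrow> 1"

definition polynomial_growth :: "(nat \<Rightarrow> real) \<Rightarrow> bool" where
  "polynomial_growth w \<longleftrightarrow> bdd_above ((\<lambda>k. (real k + 1) * \<bar>w k - 1\<bar>) ` {1..})"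

definition hardy_beta :: "(nat \<Rightarrow> real) \<Rightarrow> nat \<Rightarrow> real" where
  "hardy_beta w k = (\<Prod>j=1..k. w j)"

definition taylor_coeff :: "(complex \<Rightarrow> complex) \<Rightarrow> nat \<Rightarrow> complex" where
  "taylor_coeff f k = fps_nth (fps_expansion f 0) k"

text \<open>Functions on the open unit disk are total functions that vanish outside it, so that
  equality of functions is equality on the disk.\<close>

definition weighted_hardy :: "(nat \<Rightarrow> real) \<Rightarrow> (complex \<Rightarrow> complex) cspace" where
  "weighted_hardy w =
     \<lparr> elems = {f. f holomorphic_on ball 0 1 \<and> (\<forall>z. z \<notin> ball 0 1 \<longrightarrow> f z = 0) \<and>
                   summable (\<lambda>k. (cmod (taylor_coeff f k))\<^sup>2 * (hardy_beta w k)\<^sup>2)},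
       vplus = (\<lambda>f g z. f z + g z),
       vscale = (\<lambda>c f z. c * f z),
       vnorm = (\<lambda>f. sqrt (\<Sum>k. (cmod (taylor_coeff f k))\<^sup>2 * (hardy_beta w k)\<^sup>2)) \<rparr>"

definition mult_operator ::
    "(complex \<Rightarrow> complex) \<Rightarrow> (complex \<Rightarrow> complex) \<Rightarrow> (complex \<Rightarrow> complex)" where
  "mult_operator f g = (\<lambda>z. f z * g z)"

text \<open>Only the values of the Blaschke product on the disk are prescribed.\<close>

definition finite_blaschke_product :: "nat \<Rightarrow> (complex \<Rightarrow> complex) \<Rightarrow> bool" where
  "finite_blaschke_product m B \<longleftrightarrow>
     m \<ge> 1 \<and>
     (\<exists>(\<theta>::real) a. (\<forall>j\<in>{1..m}. a j \<in> ball 0 1) \<and>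
        (\<forall>z\<in>ball 0 1. B z = cis \<theta> * (\<Prod>j=1..m. (a j - z) / (1 - cnj (a j) * z))))"

end

theory Submission
  imports Defs "HOL-Library.Discrete_Functions"
begin

text \<open>Let \<open>e\<^sub>1, \<dots>, e\<^sub>m\<close> be the Takenaka basis of \<open>H\<^sup>2 \<ominus> B H\<^sup>2\<close>.  In the unweighted Hardy space the
  synthesis map \<open>(F\<^sub>1, \<dots>, F\<^sub>m) \<mapsto> \<Sum>j. e\<^sub>j (F\<^sub>j \<circ> B)\<close> is unitary and intertwines the direct sum of
  copies of \<open>M\<^sub>z\<close> with \<open>M\<^sub>B\<close>.  Since \<open>B\<close> and the \<open>e\<^sub>j\<close> are analytic across the unit circle and \<open>B\<close> maps
  the disk into itself, the matrix entries of this map, the coefficients of \<open>z\<^sup>k\<close> in \<open>e\<^sub>j B\<^sup>n\<close>, decay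
  exponentially outside a sector \<open>n / L \<le> k \<le> L n\<close>, while polynomial growth makes
  \<open>\<beta>\<^sub>k\<close> and \<open>\<beta>\<^sub>n\<close> comparable inside it.  Hence the synthesis map and the adjoint matrix stay
  bounded for the weighted norms.  The adjoint is a right inverse, and synthesis is injective, so
  the two are mutually inverse.\<close>

subsection \<open>Matrices on weighted sequence spaces\<close>

text \<open>Near the diagonal, absolute values of the entries give no bound; only the estimate for
  the unweighted form is available. A ratio \<open>\<beta> k / \<beta> n\<close> splits into one
  factor for each vector, but over all indices these factors are unbounded. On a pair of
  neighbouring dyadic blocks a common rescaling bounds both, and each block has boundedly many
  neighbours. The decay elsewhere comes from Cauchy estimates on two circles: on one inside the disk
  B is small, so high powers are small; on one slightly outside B is barely larger than 1, so high
  coefficients are small. The right inverse comes algebraically from the reproducing kernel of the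
  model space, with no integral over the circle. The kernel gives orthonormality of the rows of the
  matrix only; for the other inverse, orthonormality of the columns is replaced by injectivity,
  proved by cancelling zeros.\<close>

definition form_bounded :: "(nat \<Rightarrow> nat \<Rightarrow> complex) \<Rightarrow> real \<Rightarrow> bool" where
  "form_bounded u C \<longleftrightarrow> 0 \<le> C \<and> (\<forall>A A' x y. finite A \<longrightarrow> finite A' \<longrightarrow>
     cmod (\<Sum>k\<in>A. \<Sum>n\<in>A'. y k * u k n * x n)
       \<le> C * L2_set (\<lambda>k. cmod (y k)) A * L2_set (\<lambda>n. cmod (x n)) A')"

lemma form_boundedD:
  "form_bounded u C \<Longrightarrow> finite A \<Longrightarrow> finite A' \<Longrightarrow>
     cmod (\<Sum>k\<in>A. \<Sum>n\<in>A'. y k * u k n * x n)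
       \<le> C * L2_set (\<lambda>k. cmod (y k)) A * L2_set (\<lambda>n. cmod (x n)) A'"
  unfolding form_bounded_def by blast

text \<open>Conjugating the form exchanges the roles of the two vectors. Since
  \<open>form_bounded\<close> speaks of finite sections only, the sums are swapped with no question
  of convergence.\<close>

lemma form_bounded_adjoint:
  assumes "form_bounded u C"
  shows "form_bounded (\<lambda>k n. cnj (u n k)) C"
  unfolding form_bounded_def
proof (intro conjI allI impI)
  show "0 \<le> C" using assms unfolding form_bounded_def by blast
  fix A A' :: "nat set" and x y :: "nat \<Rightarrow> complex"
  assume fin: "finite A" "finite A'"
  have "(\<Sum>k\<in>A. \<Sum>n\<in>A'. y k * cnj (u n k) * x n)
      = cnj (\<Sum>n\<in>A'. \<Sum>k\<in>A. cnj (x n) * u n k * cnj (y k))"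
    by (subst sum.swap) (simp add: ac_simps)
  also have "cmod \<dots> \<le> C * L2_set (\<lambda>k. cmod (cnj (x k))) A' * L2_set (\<lambda>k. cmod (cnj (y k))) A"
    unfolding complex_mod_cnj by (rule form_boundedD[OF assms fin(2,1), THEN order_trans]) simp
  finally show "cmod (\<Sum>k\<in>A. \<Sum>n\<in>A'. y k * cnj (u n k) * x n)
      \<le> C * L2_set (\<lambda>k. cmod (y k)) A * L2_set (\<lambda>n. cmod (x n)) A'"
    by (simp add: ac_simps)
qed

text \<open>The features of \<open>hardy_beta\<close> on which the proof rests: neither the weight
  nor its reciprocal grows exponentially, and it varies by a bounded factor over each sector. The
  shift by \<open>Suc\<close> keeps the index 0 inside sectors.\<close>

locale regular_weight =
  fixes \<beta> :: "nat \<Rightarrow> real"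
  assumes pos: "\<And>k. 0 < \<beta> k"
    and summable_weight: "\<And>\<rho>. 0 < \<rho> \<Longrightarrow> \<rho> < 1 \<Longrightarrow> summable (\<lambda>k. \<rho> ^ k * \<beta> k)"
    and summable_inverse_weight: "\<And>\<rho>. 0 < \<rho> \<Longrightarrow> \<rho> < 1 \<Longrightarrow> summable (\<lambda>k. \<rho> ^ k / \<beta> k)"
    and comparable: "\<And>L. \<exists>K>0. \<forall>k n. Suc k \<le> L * Suc n \<longrightarrow> Suc n \<le> L * Suc k \<longrightarrow> \<beta> k \<le> K * \<beta> n"

definition weighted_l2 :: "(nat \<Rightarrow> real) \<Rightarrow> (nat \<Rightarrow> complex) \<Rightarrow> bool" where
  "weighted_l2 \<beta> x \<longleftrightarrow> summable (\<lambda>k. (cmod (x k))\<^sup>2 * (\<beta> k)\<^sup>2)"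

definition weighted_norm :: "(nat \<Rightarrow> real) \<Rightarrow> (nat \<Rightarrow> complex) \<Rightarrow> real" where
  "weighted_norm \<beta> x = sqrt (\<Sum>k. (cmod (x k))\<^sup>2 * (\<beta> k)\<^sup>2)"

text \<open>Schur's test in its simplest form: each index has at most 2d + 1 neighbours, so
  Cauchy-Schwarz over the set of pairs repeats every square at most that often.\<close>

lemma sum_near_diagonal_le:
  fixes f g :: "nat \<Rightarrow> real"
  assumes "finite P"
  shows "(\<Sum>(p,q)\<in>{(p,q). p \<in> P \<and> q \<in> P \<and> p \<le> q + d \<and> q \<le> p + d}. f p * g q)
           \<le> (2 * real d + 1) * (L2_set f P * L2_set g P)"
proof -
  define R where "R = {(p,q). p \<in> P \<and> q \<in> P \<and> p \<le> q + d \<and> q \<le> p + d}"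
  have finR: "finite R" 
    by (rule finite_subset[of _ "P \<times> P"]) (auto simp: R_def assms)
  have card: "card {q\<in>P. p \<le> q + d \<and> q \<le> p + d} \<le> 2 * d + 1" for p
  proof -
    have "card {q\<in>P. p \<le> q + d \<and> q \<le> p + d} \<le> card {p - d..p + d}"
      by (intro card_mono) auto
    thus ?thesis by simp
  qed
  have R1: "R = (SIGMA p:P. {q\<in>P. p \<le> q + d \<and> q \<le> p + d})" by (auto simp: R_def)
  have s1: "(\<Sum>(p,q)\<in>R. (h p)\<^sup>2) \<le> (2 * real d + 1) * (\<Sum>p\<in>P. (h p)\<^sup>2)" for h :: "nat \<Rightarrow> real"
  proof -
    have "(\<Sum>(p,q)\<in>R. (h p)\<^sup>2) = (\<Sum>p\<in>P. real (card {q\<in>P. p \<le> q + d \<and> q \<le> p + d}) * (h p)\<^sup>2)"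
      unfolding R1 by (subst sum.Sigma[symmetric]) (auto simp: assms)
    also have "\<dots> \<le> (\<Sum>p\<in>P. (2 * real d + 1) * (h p)\<^sup>2)"
    proof (intro sum_mono mult_right_mono)
      fix p show "real (card {q \<in> P. p \<le> q + d \<and> q \<le> p + d}) \<le> 2 * real d + 1"
        using card[of p] by linarith
    qed simp
    finally show ?thesis by (simp add: sum_distrib_left)
  qed
  have s2: "(\<Sum>(p,q)\<in>R. (h q)\<^sup>2) \<le> (2 * real d + 1) * (\<Sum>p\<in>P. (h p)\<^sup>2)" for h :: "nat \<Rightarrow> real"
  proof -
    have "(\<Sum>(p,q)\<in>R. (h q)\<^sup>2) = (\<Sum>(p,q)\<in>R. (h p)\<^sup>2)"
      by (rule sum.reindex_bij_witness[of _ "\<lambda>(p,q). (q,p)" "\<lambda>(p,q). (q,p)"]) (auto simp: R_def)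
    with s1[of h] show ?thesis by simp
  qed
  have "(\<Sum>(p,q)\<in>R. f p * g q) \<le> (\<Sum>x\<in>R. \<bar>f (fst x)\<bar> * \<bar>g (snd x)\<bar>)"
    by (intro sum_mono) (auto simp: abs_mult[symmetric])
  also have "\<dots> \<le> L2_set (f \<circ> fst) R * L2_set (g \<circ> snd) R"
    using L2_set_mult_ineq[of "f \<circ> fst" "g \<circ> snd" R] by simp
  also have "\<dots> \<le> (sqrt (2 * real d + 1) * L2_set f P) * (sqrt (2 * real d + 1) * L2_set g P)"
  proof (intro mult_mono)
    show "L2_set (f \<circ> fst) R \<le> sqrt (2 * real d + 1) * L2_set f P"
      using s1[of f] by (simp add: L2_set_def real_sqrt_mult[symmetric] case_prod_beta)
    show "L2_set (g \<circ> snd) R \<le> sqrt (2 * real d + 1) * L2_set g P"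
      using s2[of g] by (simp add: L2_set_def real_sqrt_mult[symmetric] case_prod_beta)
  qed auto
  also have "\<dots> = (2 * real d + 1) * (L2_set f P * L2_set g P)"
    by (simp add: algebra_simps flip: power2_eq_square)
  finally show ?thesis unfolding R_def .
qed

lemma L2_set_blocks:
  assumes "finite A" "finite P" "b ` A \<subseteq> P"
  shows "L2_set (\<lambda>p. L2_set f {k\<in>A. b k = p}) P = L2_set f A"
proof -
  have "(\<Sum>p\<in>P. (L2_set f {k\<in>A. b k = p})\<^sup>2) = (\<Sum>p\<in>P. \<Sum>k\<in>{k\<in>A. b k = p}. (f k)\<^sup>2)"
    by (simp add: L2_set_def sum_nonneg)
  also have "\<dots> = (\<Sum>k\<in>A. (f k)\<^sup>2)"
    using assms by (rule sum.group)
  finally show ?thesis by (simp add: L2_set_def)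
qed

text \<open>The block index of \<open>k\<close> is the integer part of \<open>log\<^sub>2 (k + 1)\<close>.  Far from the diagonal the decay
  of the entries beats the weights; close to it the weights are almost constant on each pair
  of blocks, where boundedness of the unweighted form applies.\<close>

lemma (in regular_weight) form_bounded_weighted:
  fixes u :: "nat \<Rightarrow> nat \<Rightarrow> complex"
  assumes u: "form_bounded u 1"
    and \<rho>: "0 < \<rho>" "\<rho> < 1" and M: "0 \<le> M"
    and decay: "\<And>k n. L * Suc n \<le> Suc k \<or> L * Suc k \<le> Suc n \<Longrightarrow> cmod (u k n) \<le> M * \<rho> ^ (k + n)"
  shows "\<exists>C. form_bounded (\<lambda>k n. of_real (\<beta> k) * u k n / \<beta> n) C"
proof -
  define b where "b k = floor_log (Suc k)" for k
  \<comment> \<open>Measured in dyadic blocks, the factor L becomes a shift by d: blocks more than d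
    apart lie in the region of decay.\<close>
  obtain d :: nat where d: "L < 2 ^ d" using less_exp by blast
  have b1: "2 ^ b k \<le> Suc k" for k unfolding b_def by (rule floor_log_exp2_le) simp
  have b2: "Suc k < 2 * 2 ^ b k" for k unfolding b_def by (rule floor_log_exp2_gt)
  have near: "Suc k \<le> 2 ^ (d + 1) * Suc n" if "b k \<le> b n + d" for k n
  proof -
    have "Suc k \<le> 2 * 2 ^ b k" using b2[of k] by simp
    also have "\<dots> \<le> 2 * 2 ^ (b n + d)" using that by (intro mult_left_mono power_increasing) auto
    also have "\<dots> = 2 ^ (d + 1) * 2 ^ b n" by (simp add: power_add)
    also have "\<dots> \<le> 2 ^ (d + 1) * Suc n" using b1[of n] by (intro mult_left_mono) auto
    finally show ?thesis .
  qed
  have far: "L * Suc n \<le> Suc k" if "\<not> b k \<le> b n + d" for k n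
  proof -
    have "L * Suc n \<le> 2 ^ d * (2 * 2 ^ b n)"
      using d b2[of n] by (intro mult_mono) auto
    also have "\<dots> = 2 ^ (b n + d + 1)" by (simp add: power_add)
    also have "\<dots> \<le> 2 ^ b k" using that by (intro power_increasing) auto
    also have "\<dots> \<le> Suc k" by (rule b1)
    finally show ?thesis .
  qed
  obtain K where K: "K > 0"
    "\<And>k n. Suc k \<le> 4 * 2 ^ (d + 1) * Suc n \<Longrightarrow> Suc n \<le> 4 * 2 ^ (d + 1) * Suc k \<Longrightarrow> \<beta> k \<le> K * \<beta> n"
    using comparable[of "4 * 2 ^ (d + 1)"] by blast
  have comp: "\<beta> k \<le> K * \<beta> n" if "b k \<le> b n + d" "b n \<le> b k + d" for k n
    using near[OF that(1)] near[OF that(2)] by (intro K(2)) auto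
  define nr where "nr k n \<longleftrightarrow> b k \<le> b n + d \<and> b n \<le> b k + d" for k n
  define C1 where "C1 = sqrt (\<Sum>k. (\<rho> ^ k * \<beta> k)\<^sup>2)"
  define C2 where "C2 = sqrt (\<Sum>k. (\<rho> ^ k / \<beta> k)\<^sup>2)"
  \<comment> \<open>The terms are eventually below 1, where squaring decreases them.\<close>
  have sq: "summable (\<lambda>k. (f k)\<^sup>2)" if "summable f" "\<And>k. 0 \<le> f k" for f :: "nat \<Rightarrow> real"
  proof -
    have "f \<longlonglongrightarrow> 0" using that(1) by (rule summable_LIMSEQ_zero)
    hence "eventually (\<lambda>k. f k < 1) sequentially" by (rule order_tendstoD) simp
    hence "eventually (\<lambda>k. norm ((f k)\<^sup>2) \<le> f k) sequentially"
    proof eventually_elim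
      case (elim k)
      have "f k * f k \<le> f k * 1" using elim that(2)[of k] by (intro mult_left_mono) auto
      thus ?case by (simp add: power2_eq_square)
    qed
    thus ?thesis using that(1) by (rule summable_comparison_test_ev)
  qed
  have L1: "L2_set (\<lambda>k. \<rho> ^ k * \<beta> k) A \<le> C1" if "finite A" for A
    unfolding L2_set_def C1_def using pos \<rho> that
    by (intro real_sqrt_le_mono sum_le_suminf sq summable_weight) (auto simp: less_imp_le)
  have L2: "L2_set (\<lambda>k. \<rho> ^ k / \<beta> k) A \<le> C2" if "finite A" for A
    unfolding L2_set_def C2_def using pos \<rho> that
    by (intro real_sqrt_le_mono sum_le_suminf sq summable_inverse_weight) (auto simp: less_imp_le)
  have C0: "0 \<le> C1" "0 \<le> C2" using L1[of "{}"] L2[of "{}"] by auto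
  define C where "C = K * (2 * real d + 1) + M * C1 * C2"
  have "form_bounded (\<lambda>k n. \<beta> k * u k n / \<beta> n) C"
    unfolding form_bounded_def
  proof (intro conjI allI impI)
    show "0 \<le> C" using K(1) M C0 by (auto simp: C_def)
    fix A A' :: "nat set" and x y :: "nat \<Rightarrow> complex"
    assume fin: "finite A" "finite A'"
    define t where "t k n = y k * (\<beta> k * u k n / \<beta> n) * x n" for k n
    define Y where "Y = L2_set (\<lambda>k. cmod (y k)) A"
    define X where "X = L2_set (\<lambda>k. cmod (x k)) A'"
    have XY0: "0 \<le> X" "0 \<le> Y" by (auto simp: X_def Y_def)
    have split: "(\<Sum>k\<in>A. \<Sum>n\<in>A'. t k n)
        = (\<Sum>k\<in>A. \<Sum>n\<in>A'. if nr k n then t k n else 0) + (\<Sum>k\<in>A. \<Sum>n\<in>A'. if nr k n then 0 else t k n)"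
      unfolding sum.distrib[symmetric] by (intro sum.cong) auto
    have farb: "cmod (\<Sum>k\<in>A. \<Sum>n\<in>A'. if nr k n then 0 else t k n) \<le> M * C1 * C2 * (Y * X)"
    proof -
      have "cmod (\<Sum>k\<in>A. \<Sum>n\<in>A'. if nr k n then 0 else t k n)
          \<le> (\<Sum>k\<in>A. \<Sum>n\<in>A'. M * (\<bar>\<rho> ^ k * \<beta> k\<bar> * \<bar>cmod (y k)\<bar>) * (\<bar>\<rho> ^ n / \<beta> n\<bar> * \<bar>cmod (x n)\<bar>))"
      proof (intro sum_norm_le)
        fix k n
        have p: "0 < \<beta> k" "0 < \<beta> n" using pos by auto
        show "cmod (if nr k n then 0 else t k n)
           \<le> M * (\<bar>\<rho> ^ k * \<beta> k\<bar> * \<bar>cmod (y k)\<bar>) * (\<bar>\<rho> ^ n / \<beta> n\<bar> * \<bar>cmod (x n)\<bar>)"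
        proof (cases "nr k n")
          case True
          thus ?thesis using M by simp
        next
          case False
          hence "cmod (u k n) \<le> M * \<rho> ^ (k + n)"
            unfolding nr_def using far[of k n] far[of n k] by (intro decay) auto
          hence "cmod (y k) * (\<beta> k * cmod (u k n) / \<beta> n) * cmod (x n)
              \<le> cmod (y k) * (\<beta> k * (M * \<rho> ^ (k + n)) / \<beta> n) * cmod (x n)"
            using p by (intro mult_right_mono mult_left_mono divide_right_mono) auto
          also have "\<dots> = M * (\<bar>\<rho> ^ k * \<beta> k\<bar> * \<bar>cmod (y k)\<bar>) * (\<bar>\<rho> ^ n / \<beta> n\<bar> * \<bar>cmod (x n)\<bar>)"
            using p \<rho> by (simp add: abs_mult power_add)
          finally show ?thesis using False p by (simp add: t_def norm_mult norm_divide)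
        qed
      qed
      also have "\<dots> = M * (\<Sum>k\<in>A. \<bar>\<rho> ^ k * \<beta> k\<bar> * \<bar>cmod (y k)\<bar>) * (\<Sum>n\<in>A'. \<bar>\<rho> ^ n / \<beta> n\<bar> * \<bar>cmod (x n)\<bar>)"
        by (simp only: sum_distrib_left sum_distrib_right) (subst sum.swap, rule refl)
      also have "\<dots> \<le> M * (C1 * Y) * (C2 * X)"
      proof -
        have "(\<Sum>k\<in>A. \<bar>\<rho> ^ k * \<beta> k\<bar> * \<bar>cmod (y k)\<bar>) \<le> C1 * Y"
          unfolding Y_def
          by (rule order_trans[OF L2_set_mult_ineq]) (intro mult_right_mono L1 fin L2_set_nonneg)
        moreover have "(\<Sum>k\<in>A'. \<bar>\<rho> ^ k / \<beta> k\<bar> * \<bar>cmod (x k)\<bar>) \<le> C2 * X"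
          unfolding X_def
          by (rule order_trans[OF L2_set_mult_ineq]) (intro mult_right_mono L2 fin L2_set_nonneg)
        ultimately show ?thesis
          using M C0 XY0 by (intro mult_mono) (auto intro!: sum_nonneg mult_nonneg_nonneg)
      qed
      finally show ?thesis by (simp add: ac_simps)
    qed
    define P where "P = b ` A \<union> b ` A'"
    have finP: "finite P" using fin by (simp add: P_def)
    define Ap where "Ap p = {k\<in>A. b k = p}" for p
    define Aq where "Aq q = {n\<in>A'. b n = q}" for q
    define R where "R = {(p,q). p \<in> P \<and> q \<in> P \<and> p \<le> q + d \<and> q \<le> p + d}"
    have finA: "finite (Ap p)" "finite (Aq p)" for p using fin by (auto simp: Ap_def Aq_def)
    have finR: "finite R" by (rule finite_subset[of _ "P \<times> P"]) (auto simp: R_def finP)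
    have nearb: "cmod (\<Sum>k\<in>A. \<Sum>n\<in>A'. if nr k n then t k n else 0) \<le> K * (2 * real d + 1) * (Y * X)"
    proof -
      have "(\<Sum>k\<in>A. \<Sum>n\<in>A'. if nr k n then t k n else 0)
          = (\<Sum>p\<in>P. \<Sum>k\<in>Ap p. \<Sum>q\<in>P. \<Sum>n\<in>Aq q. if nr k n then t k n else 0)"
        unfolding Ap_def Aq_def
        by (subst sum.group[of A', symmetric, where T = P and g = b])
           (use fin finP in \<open>auto simp: P_def sum.group\<close>)
      also have "\<dots> = (\<Sum>p\<in>P. \<Sum>q\<in>P. \<Sum>k\<in>Ap p. \<Sum>n\<in>Aq q. if nr k n then t k n else 0)"
        by (intro sum.cong refl sum.swap)
      \<comment> \<open>\<open>nr\<close> depends on the block indices alone, so a pair of blocks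
        contributes entirely or not at all. This leaves complete rectangles, to which the form bound
        applies.\<close>
      also have "\<dots> = (\<Sum>p\<in>P. \<Sum>q\<in>P. if (p,q) \<in> R then \<Sum>k\<in>Ap p. \<Sum>n\<in>Aq q. t k n else 0)"
        by (intro sum.cong refl) (auto simp: R_def Ap_def Aq_def nr_def intro!: sum.cong)
      also have "\<dots> = (\<Sum>(p,q)\<in>R. \<Sum>k\<in>Ap p. \<Sum>n\<in>Aq q. t k n)"
        unfolding sum.cartesian_product using finP
        by (intro sum.mono_neutral_cong_right) (auto simp: R_def split: if_splits)
      also have "cmod \<dots> \<le> (\<Sum>(p,q)\<in>R. K * (L2_set (\<lambda>k. cmod (y k)) (Ap p) * L2_set (\<lambda>k. cmod (x k)) (Aq q)))"
      proof (intro sum_norm_le, clarify)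
        fix p q assume pq: "(p,q) \<in> R"
        show "cmod (\<Sum>k\<in>Ap p. \<Sum>n\<in>Aq q. t k n)
               \<le> K * (L2_set (\<lambda>k. cmod (y k)) (Ap p) * L2_set (\<lambda>k. cmod (x k)) (Aq q))"
        proof (cases "Ap p = {}")
          case False
          \<comment> \<open>The largest weight of the row block splits the ratio into
            \<open>\<beta> k / S\<close> and \<open>S / \<beta> n\<close>: the first is at most 1
            and is absorbed by y, the second is at most K and is absorbed by x.\<close>
          define S where "S = Max (\<beta> ` Ap p)"
          have "S \<in> \<beta> ` Ap p" unfolding S_def using False finA by (intro Max_in) auto
          then obtain k0 where k0: "k0 \<in> Ap p" "S = \<beta> k0" by auto
          have S0: "0 < S" using k0 pos by auto
          have Sle: "\<beta> k \<le> S" if "k \<in> Ap p" for k unfolding S_def using that finA by auto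
          have Sx: "S / \<beta> n \<le> K" if "n \<in> Aq q" for n
          proof -
            have "\<beta> k0 \<le> K * \<beta> n" using that k0 pq by (intro comp) (auto simp: Ap_def Aq_def R_def)
            thus ?thesis using pos[of n] k0 by (simp add: field_simps)
          qed
          have "(\<Sum>k\<in>Ap p. \<Sum>n\<in>Aq q. t k n)
              = (\<Sum>k\<in>Ap p. \<Sum>n\<in>Aq q. (of_real (\<beta> k / S) * y k) * u k n * (of_real (S / \<beta> n) * x n))"
            using S0 by (intro sum.cong) (auto simp: t_def)
          also have "cmod \<dots> \<le> 1 * L2_set (\<lambda>k. cmod (of_real (\<beta> k / S) * y k)) (Ap p) *
                              L2_set (\<lambda>n. cmod (of_real (S / \<beta> n) * x n)) (Aq q)"
            by (intro form_boundedD u finA)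
          also have "\<dots> \<le> 1 * L2_set (\<lambda>k. cmod (y k)) (Ap p) * (K * L2_set (\<lambda>n. cmod (x n)) (Aq q))"
          proof (intro mult_mono)
            show "L2_set (\<lambda>k. cmod (of_real (\<beta> k / S) * y k)) (Ap p) \<le> L2_set (\<lambda>k. cmod (y k)) (Ap p)"
            proof (intro L2_set_mono)
              fix k assume "k \<in> Ap p"
              hence "\<beta> k / S \<le> 1" using Sle S0 by simp
              thus "cmod (of_real (\<beta> k / S) * y k) \<le> cmod (y k)"
                using S0 pos[of k] mult_right_mono[of "\<beta> k / S" 1 "cmod (y k)"]
                by (simp add: norm_mult norm_divide)
            qed auto
            have "L2_set (\<lambda>n. cmod (of_real (S / \<beta> n) * x n)) (Aq q) \<le> L2_set (\<lambda>n. K * cmod (x n)) (Aq q)"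
            proof (intro L2_set_mono)
              fix n assume "n \<in> Aq q"
              thus "cmod (of_real (S / \<beta> n) * x n) \<le> K * cmod (x n)"
                using Sx[of n] S0 pos[of n] mult_right_mono[of "S / \<beta> n" K "cmod (x n)"]
                by (simp add: norm_mult norm_divide)
            qed auto
            also have "\<dots> = K * L2_set (\<lambda>n. cmod (x n)) (Aq q)"
              using K(1) by (simp add: L2_set_right_distrib)
            finally show "L2_set (\<lambda>n. cmod (of_real (S / \<beta> n) * x n)) (Aq q) \<le> K * L2_set (\<lambda>n. cmod (x n)) (Aq q)" .
          qed auto
          finally show ?thesis by (simp add: ac_simps)
        qed auto
      qed
      also have "\<dots> = K * (\<Sum>(p,q)\<in>R. L2_set (\<lambda>k. cmod (y k)) (Ap p) * L2_set (\<lambda>k. cmod (x k)) (Aq q))"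
        by (simp add: sum_distrib_left case_prod_beta)
      also have "\<dots> \<le> K * ((2 * real d + 1) * (L2_set (\<lambda>p. L2_set (\<lambda>k. cmod (y k)) (Ap p)) P
                        * L2_set (\<lambda>q. L2_set (\<lambda>k. cmod (x k)) (Aq q)) P))"
        unfolding R_def using K(1) by (intro mult_left_mono sum_near_diagonal_le finP) auto
      also have "\<dots> = K * ((2 * real d + 1) * (Y * X))"
        unfolding Ap_def Aq_def Y_def X_def by (subst (1 2) L2_set_blocks) (use fin finP in \<open>auto simp: P_def\<close>)
      finally show ?thesis by (simp add: ac_simps)
    qed
    have "cmod (\<Sum>k\<in>A. \<Sum>n\<in>A'. t k n) \<le> K * (2 * real d + 1) * (Y * X) + M * C1 * C2 * (Y * X)"
      unfolding split by (rule norm_triangle_le) (intro add_mono nearb farb)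
    also have "\<dots> = C * Y * X" by (simp add: C_def algebra_simps)
    finally show "cmod (\<Sum>k\<in>A. \<Sum>n\<in>A'. y k * (\<beta> k * u k n / \<beta> n) * x n)
        \<le> C * L2_set (\<lambda>k. cmod (y k)) A * L2_set (\<lambda>n. cmod (x n)) A'"
      by (simp add: t_def Y_def X_def)
  qed
  thus ?thesis by blast
qed

section \<open>Weighted sequence spaces and matrix operators on them\<close>

lemma L2_set_le_weighted_norm:
  assumes "weighted_l2 \<beta> x" "finite A"
  shows "L2_set (\<lambda>k. cmod (x k) * \<beta> k) A \<le> weighted_norm \<beta> x"
  using assms unfolding L2_set_def weighted_norm_def weighted_l2_def
  by (intro real_sqrt_le_mono) (simp add: power_mult_distrib sum_le_suminf)

lemma weighted_normI:
  assumes "\<And>N. L2_set (\<lambda>k. cmod (x k) * \<beta> k) {..<N} \<le> C"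
  shows "weighted_l2 \<beta> x" "weighted_norm \<beta> x \<le> C"
proof -
  have C: "0 \<le> C" using assms[of 0] by simp
  have le: "(\<Sum>k<N. (cmod (x k))\<^sup>2 * (\<beta> k)\<^sup>2) \<le> C\<^sup>2" for N
    using assms[of N] C unfolding L2_set_def by (simp add: power_mult_distrib real_le_lsqrt sqrt_le_D)
  show 1: "weighted_l2 \<beta> x"
    unfolding weighted_l2_def by (rule summableI_nonneg_bounded[OF _ le]) simp
  have "(\<Sum>k. (cmod (x k))\<^sup>2 * (\<beta> k)\<^sup>2) \<le> C\<^sup>2"
    using 1 unfolding weighted_l2_def by (rule suminf_le_const[OF _ le])
  thus "weighted_norm \<beta> x \<le> C"
    unfolding weighted_norm_def using C by (rule real_le_lsqrt[rotated])
qed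

lemma weighted_norm_nonneg: "weighted_l2 \<beta> x \<Longrightarrow> 0 \<le> weighted_norm \<beta> x"
  using L2_set_le_weighted_norm[of \<beta> x "{}"] by simp

text \<open>Duality on finite sections: testing the truncated image, of norm V, against its own
  conjugate bounds V^2 by V times the desired bound, and one factor V cancels. The truncation of the
  columns is then removed by a limit in finitely many coordinates at a time.\<close>

lemma (in regular_weight) matrix_operator_bounded:
  fixes u :: "nat \<Rightarrow> nat \<Rightarrow> complex"
  assumes u: "form_bounded (\<lambda>k n. of_real (\<beta> k) * u k n / of_real (\<beta> n)) C"
    and x: "weighted_l2 \<beta> x"
    and sums: "\<And>k. summable (\<lambda>n. u k n * x n)"
  shows "weighted_l2 \<beta> (\<lambda>k. \<Sum>n. u k n * x n)"
    and "weighted_norm \<beta> (\<lambda>k. \<Sum>n. u k n * x n) \<le> C * weighted_norm \<beta> x"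
proof -
  have C: "0 \<le> C" using u unfolding form_bounded_def by blast
  have fin: "L2_set (\<lambda>k. cmod (\<Sum>n<N. u k n * x n) * \<beta> k) {..<m} \<le> C * weighted_norm \<beta> x" for m N
  proof -
    define v where "v k = of_real (\<beta> k) * (\<Sum>n<N. u k n * x n)" for k
    have v: "c * v k = (\<Sum>n<N. c * (of_real (\<beta> k) * u k n / of_real (\<beta> n)) * (of_real (\<beta> n) * x n))" for c k
      using pos by (simp add: v_def sum_distrib_left mult_ac less_imp_neq[symmetric])
    define V where "V = L2_set (\<lambda>k. cmod (v k)) {..<m}"
    have "V\<^sup>2 = (\<Sum>k<m. (cmod (v k))\<^sup>2)" by (simp add: V_def L2_set_def sum_nonneg)
    also have "complex_of_real \<dots> = (\<Sum>k<m. cnj (v k) * v k)"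
      unfolding of_real_sum by (intro sum.cong refl) (subst complex_norm_square, simp)
    also have "\<dots> = (\<Sum>k<m. \<Sum>n<N. cnj (v k) * (of_real (\<beta> k) * u k n / of_real (\<beta> n)) * (of_real (\<beta> n) * x n))"
      by (intro sum.cong refl v)
    finally have "V\<^sup>2 = cmod (\<Sum>k<m. \<Sum>n<N. cnj (v k) * (of_real (\<beta> k) * u k n / of_real (\<beta> n)) * (of_real (\<beta> n) * x n))"
      by (metis norm_of_real abs_power2)
    also have "\<dots> \<le> C * L2_set (\<lambda>k. cmod (cnj (v k))) {..<m} * L2_set (\<lambda>n. cmod (of_real (\<beta> n) * x n)) {..<N}"
      by (rule form_boundedD[OF u]) auto
    also have "L2_set (\<lambda>n. cmod (of_real (\<beta> n) * x n)) {..<N} = L2_set (\<lambda>n. cmod (x n) * \<beta> n) {..<N}"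
      using pos by (simp add: norm_mult mult.commute less_imp_le)
    also have "C * L2_set (\<lambda>k. cmod (cnj (v k))) {..<m} * \<dots> \<le> C * V * weighted_norm \<beta> x"
      using C x by (auto simp: V_def intro!: mult_left_mono L2_set_le_weighted_norm)
    finally have "V * V \<le> V * (C * weighted_norm \<beta> x)" by (simp add: power2_eq_square mult_ac)
    moreover have "0 \<le> V" "0 \<le> C * weighted_norm \<beta> x"
      using C x weighted_norm_nonneg by (auto simp: V_def)
    ultimately have "V \<le> C * weighted_norm \<beta> x"
      by (metis mult_le_cancel_left_pos order_le_less)
    thus ?thesis using pos by (simp add: V_def v_def norm_mult mult.commute less_imp_le)
  qed
  have lim: "L2_set (\<lambda>k. cmod (\<Sum>n. u k n * x n) * \<beta> k) {..<m} \<le> C * weighted_norm \<beta> x" for m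
  proof (rule LIMSEQ_le_const2)
    show "(\<lambda>N. L2_set (\<lambda>k. cmod (\<Sum>n<N. u k n * x n) * \<beta> k) {..<m})
            \<longlonglongrightarrow> L2_set (\<lambda>k. cmod (\<Sum>n. u k n * x n) * \<beta> k) {..<m}"
      unfolding L2_set_def by (intro tendsto_intros summable_LIMSEQ sums)
  qed (use fin in blast)
  show "weighted_l2 \<beta> (\<lambda>k. \<Sum>n. u k n * x n)"
    and "weighted_norm \<beta> (\<lambda>k. \<Sum>n. u k n * x n) \<le> C * weighted_norm \<beta> x"
    by (rule weighted_normI[OF lim])+
qed

lemma weighted_l2_add:
  assumes "weighted_l2 \<beta> x" "weighted_l2 \<beta> y"
  shows "weighted_l2 \<beta> (\<lambda>k. x k + y k)" "weighted_norm \<beta> (\<lambda>k. x k + y k) \<le> weighted_norm \<beta> x + weighted_norm \<beta> y"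
proof -
  have "L2_set (\<lambda>k. cmod (x k + y k) * \<beta> k) {..<N} \<le> weighted_norm \<beta> x + weighted_norm \<beta> y" for N
  proof -
    \<comment> \<open>The sign of \<open>\<beta>\<close> is arbitrary here; passing to its absolute
      value is free because \<open>L2_set\<close> sees squares only.\<close>
    have "L2_set (\<lambda>k. cmod (x k + y k) * \<beta> k) {..<N} = L2_set (\<lambda>k. cmod (x k + y k) * \<bar>\<beta> k\<bar>) {..<N}"
      by (simp add: L2_set_def power_mult_distrib)
    also have "\<dots> \<le> L2_set (\<lambda>k. cmod (x k) * \<bar>\<beta> k\<bar> + cmod (y k) * \<bar>\<beta> k\<bar>) {..<N}"
      by (intro L2_set_mono) (auto simp: norm_triangle_ineq mult_right_mono simp flip: distrib_right)
    also have "\<dots> \<le> L2_set (\<lambda>k. cmod (x k) * \<bar>\<beta> k\<bar>) {..<N} + L2_set (\<lambda>k. cmod (y k) * \<bar>\<beta> k\<bar>) {..<N}"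
      by (rule L2_set_triangle_ineq)
    also have "\<dots> = L2_set (\<lambda>k. cmod (x k) * \<beta> k) {..<N} + L2_set (\<lambda>k. cmod (y k) * \<beta> k) {..<N}"
      by (simp add: L2_set_def power_mult_distrib)
    also have "\<dots> \<le> weighted_norm \<beta> x + weighted_norm \<beta> y"
      by (intro add_mono L2_set_le_weighted_norm assms) auto
    finally show ?thesis .
  qed
  thus "weighted_l2 \<beta> (\<lambda>k. x k + y k)" "weighted_norm \<beta> (\<lambda>k. x k + y k) \<le> weighted_norm \<beta> x + weighted_norm \<beta> y"
    by (rule weighted_normI)+
qed

lemma weighted_norm_triangle_sum:
  assumes "\<And>j. j \<in> J \<Longrightarrow> weighted_l2 \<beta> (x j)"
  shows "weighted_l2 \<beta> (\<lambda>k. \<Sum>j\<in>J. x j k)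
     \<and> weighted_norm \<beta> (\<lambda>k. \<Sum>j\<in>J. x j k) \<le> (\<Sum>j\<in>J. weighted_norm \<beta> (x j))"
  using assms
proof (induction J rule: infinite_finite_induct)
  case (insert j J)
  thus ?case using weighted_l2_add[of \<beta> "x j" "\<lambda>k. \<Sum>j\<in>J. x j k"] by auto
qed (simp_all add: weighted_l2_def weighted_norm_def)

lemma (in regular_weight) cmod_le_weighted_norm:
  assumes "weighted_l2 \<beta> x"
  shows "cmod (x k) \<le> weighted_norm \<beta> x / \<beta> k"
  using L2_set_le_weighted_norm[OF assms, of "{k}"] pos[of k]
  by (simp add: pos_le_divide_eq)

text \<open>Each coefficient is at most the norm divided by \<open>\<beta> k\<close>, and
  \<open>1 / \<beta> k\<close> grows subexponentially; hence weighted sequences define functions on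
  the whole disk.\<close>

lemma (in regular_weight) summable_coeff:
  assumes "weighted_l2 \<beta> x" "0 \<le> r" "r < 1"
  shows "summable (\<lambda>k. cmod (x k) * r ^ k)"
proof (rule summable_comparison_test')
  \<comment> \<open>The rate (1 + r) / 2 is below 1, at least r, and positive even for r =
    0.\<close>
  show "summable (\<lambda>k. weighted_norm \<beta> x * (((1 + r) / 2) ^ k / \<beta> k))"
    using assms by (intro summable_mult summable_inverse_weight) auto
  fix k :: nat
  have "cmod (x k) * r ^ k \<le> (weighted_norm \<beta> x / \<beta> k) * ((1 + r) / 2) ^ k"
    using assms pos[of k] weighted_norm_nonneg[OF assms(1)]
    by (intro mult_mono cmod_le_weighted_norm power_mono) auto
  thus "norm (cmod (x k) * r ^ k) \<le> weighted_norm \<beta> x * (((1 + r) / 2) ^ k / \<beta> k)"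
    using assms(2) by simp
qed

subsection \<open>Taylor coefficients\<close>

lemma taylor_coeff_deriv: "taylor_coeff f k = (deriv ^^ k) f 0 / fact k"
  by (simp add: taylor_coeff_def fps_expansion_def)

lemma taylor_coeff_sums:
  assumes "f holomorphic_on ball 0 r" "z \<in> ball 0 r"
  shows "(\<lambda>k. taylor_coeff f k * z ^ k) sums f z"
  using holomorphic_power_series[OF assms] by (simp add: taylor_coeff_deriv)

lemma taylor_coeff_unique:
  assumes "0 < r" "\<And>z. z \<in> ball 0 r \<Longrightarrow> (\<lambda>k. c k * z ^ k) sums f z"
  shows "taylor_coeff f = c"
proof -
  have "eventually (\<lambda>z. z \<in> ball (0::complex) r) (nhds 0)"
    using assms(1) by (intro eventually_nhds_in_open) auto
  hence "f has_fps_expansion Abs_fps c"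
    by (intro has_fps_expansionI) (auto elim!: eventually_mono intro!: assms(2))
  thus ?thesis unfolding taylor_coeff_def by (subst fps_expansion_eqI) auto
qed

lemma taylor_coeff_cong:
  assumes "0 < r" "\<And>z. z \<in> ball 0 r \<Longrightarrow> f z = g z"
  shows "taylor_coeff f = taylor_coeff g"
proof -
  have "eventually (\<lambda>z. z \<in> ball (0::complex) r) (nhds 0)"
    using assms(1) by (intro eventually_nhds_in_open) auto
  hence "eventually (\<lambda>z. f z = g z) (nhds 0)" by eventually_elim (rule assms(2))
  thus ?thesis unfolding taylor_coeff_def using fps_expansion_cong by metis
qed

lemma taylor_coeff_linear:
  assumes "0 < r" "\<And>j. j \<in> J \<Longrightarrow> f j holomorphic_on ball 0 r"
  shows "taylor_coeff (\<lambda>z. \<Sum>j\<in>J. c j * f j z) k = (\<Sum>j\<in>J. c j * taylor_coeff (f j) k)"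
proof -
  have "taylor_coeff (\<lambda>z. \<Sum>j\<in>J. c j * f j z) = (\<lambda>k. \<Sum>j\<in>J. c j * taylor_coeff (f j) k)"
  proof (rule taylor_coeff_unique[OF assms(1)])
    fix z :: complex assume "z \<in> ball 0 r"
    hence "(\<lambda>k. \<Sum>j\<in>J. c j * (taylor_coeff (f j) k * z ^ k)) sums (\<Sum>j\<in>J. c j * f j z)"
      using assms(2) by (intro sums_sum sums_mult taylor_coeff_sums)
    thus "(\<lambda>k. (\<Sum>j\<in>J. c j * taylor_coeff (f j) k) * z ^ k) sums (\<Sum>j\<in>J. c j * f j z)"
      by (simp add: sum_distrib_right mult.assoc)
  qed
  thus ?thesis by simp
qed

lemma taylor_coeff_sum:
  assumes "0 < r" "\<And>j. j \<in> J \<Longrightarrow> f j holomorphic_on ball 0 r"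
  shows "taylor_coeff (\<lambda>z. \<Sum>j\<in>J. f j z) k = (\<Sum>j\<in>J. taylor_coeff (f j) k)"
  using taylor_coeff_linear[OF assms, where c = "\<lambda>_. 1"] by simp

lemma taylor_coeff_cmult:
  assumes "0 < r" "f holomorphic_on ball 0 r"
  shows "taylor_coeff (\<lambda>z. c * f z) k = c * taylor_coeff f k"
  using taylor_coeff_linear[of r "{()}" "\<lambda>_. f" "\<lambda>_. c"] assms by simp

lemma taylor_coeff_add:
  assumes "0 < r" "f holomorphic_on ball 0 r" "g holomorphic_on ball 0 r"
  shows "taylor_coeff (\<lambda>z. f z + g z) k = taylor_coeff f k + taylor_coeff g k"
  using taylor_coeff_sum[of r UNIV "\<lambda>b. if b then f else g"] assms by (simp add: UNIV_bool add.commute)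

lemma taylor_coeff_bound:
  assumes "f holomorphic_on cball 0 r" "0 < r" "\<And>z. z \<in> cball 0 r \<Longrightarrow> cmod (f z) \<le> M"
  shows "cmod (taylor_coeff f k) \<le> M / r ^ k"
proof -
  have "cmod ((deriv ^^ k) f 0) \<le> fact k * M / r ^ k"
    using assms by (intro Cauchy_inequality)
      (auto intro: holomorphic_on_imp_continuous_on holomorphic_on_subset[of _ "cball 0 r"])
  thus ?thesis by (simp add: taylor_coeff_deriv norm_divide field_simps)
qed

text \<open>Weierstrass: a normally convergent series of holomorphic functions converges together
  with its derivatives at 0. A small disk suffices, since coefficients depend only on the germ at
  0.\<close>

lemma taylor_coeff_suminf:
  assumes r: "0 < r" and hol: "\<And>n. f n holomorphic_on ball 0 r"
    and bound: "\<And>n z. z \<in> ball 0 r \<Longrightarrow> cmod (f n z) \<le> A n" and "summable A"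
  shows "(\<lambda>n. taylor_coeff (f n) k) sums taylor_coeff (\<lambda>z. \<Sum>n. f n z) k"
proof -
  have "(\<lambda>N. (deriv ^^ k) (\<lambda>z. \<Sum>n<N. f n z) 0 / fact k)
          \<longlonglongrightarrow> (deriv ^^ k) (\<lambda>z. \<Sum>n. f n z) 0 / fact k"
    using r
    by (intro tendsto_divide tendsto_const higher_deriv_complex_uniform_limit[where A = "ball 0 r"]
          Weierstrass_m_test[OF bound \<open>summable A\<close>] always_eventually allI holomorphic_intros hol) auto
  thus ?thesis
    unfolding sums_def taylor_coeff_deriv[symmetric] by (simp add: taylor_coeff_sum[OF r hol])
qed

subsection \<open>The Takenaka basis of a finite Blaschke product\<close>

definition blaschke_factor :: "complex \<Rightarrow> complex \<Rightarrow> complex" where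
  "blaschke_factor a z = (a - z) / (1 - cnj a * z)"

text \<open>The normalised Szego kernel at \<open>a j\<close> times the preceding Blaschke factors
  (Takenaka-Malmquist functions). The products keep the functions independent when zeros are
  repeated, where the kernels alone would coincide.\<close>

definition takenaka :: "(nat \<Rightarrow> complex) \<Rightarrow> nat \<Rightarrow> complex \<Rightarrow> complex" where
  "takenaka a j z = of_real (sqrt (1 - (cmod (a j))\<^sup>2)) / (1 - cnj (a j) * z)
      * (\<Prod>i\<in>{1..<j}. blaschke_factor (a i) z)"

text \<open>Divided by \<open>1 - z * cnj y\<close>, this is the reproducing kernel of a
  one-dimensional model space, written with its normalised basis vector.\<close>

lemma blaschke_factor_kernel:
  assumes "1 - cnj a * z \<noteq> 0" "1 - cnj a * y \<noteq> 0"
  shows "1 - blaschke_factor a z * cnj (blaschke_factor a y)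
       = of_real (1 - (cmod a)\<^sup>2) * (1 - z * cnj y) / ((1 - cnj a * z) * cnj (1 - cnj a * y))"
proof -
  have nz: "1 - a * cnj y \<noteq> 0"
    using assms(2) by (metis complex_cnj_cnj complex_cnj_diff complex_cnj_mult complex_cnj_one complex_cnj_zero)
  have n: "complex_of_real (1 - (cmod a)\<^sup>2) = 1 - a * cnj a"
    by (simp only: of_real_diff complex_norm_square of_real_1)
  show ?thesis
    unfolding blaschke_factor_def n using assms(1) nz by (simp add: divide_simps) (simp add: algebra_simps)
qed

text \<open>Telescoping: appending a factor b to the product P adds
  \<open>P z * cnj (P y) * (1 - b z * cnj (b y))\<close>, which is the new summand by the one-factor
  identity.\<close>

lemma takenaka_kernel:
  assumes "\<And>j. j \<in> {1..m} \<Longrightarrow> 1 - cnj (a j) * z \<noteq> 0" "\<And>j. j \<in> {1..m} \<Longrightarrow> 1 - cnj (a j) * y \<noteq> 0"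
    and "\<And>j. j \<in> {1..m} \<Longrightarrow> cmod (a j) < 1"
  shows "(\<Sum>j\<in>{1..m}. takenaka a j z * cnj (takenaka a j y)) * (1 - z * cnj y)
     = 1 - (\<Prod>i\<in>{1..m}. blaschke_factor (a i) z) * cnj (\<Prod>i\<in>{1..m}. blaschke_factor (a i) y)"
  using assms
proof (induction m)
  case (Suc m)
  define P where "P z = (\<Prod>i\<in>{1..m}. blaschke_factor (a i) z)" for z
  define a' where "a' = a (Suc m)"
  have iv: "{1..<Suc m} = {1..m}" by auto
  have sq: "complex_of_real (sqrt (1 - (cmod a')\<^sup>2)) * of_real (sqrt (1 - (cmod a')\<^sup>2)) = of_real (1 - (cmod a')\<^sup>2)"
    using Suc.prems(3)[of "Suc m"] abs_square_le_1[of "cmod a'"]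
    by (simp add: a'_def less_imp_le flip: of_real_mult)
  have "(\<Sum>j\<in>{1..Suc m}. takenaka a j z * cnj (takenaka a j y)) * (1 - z * cnj y)
     = (\<Sum>j\<in>{1..m}. takenaka a j z * cnj (takenaka a j y)) * (1 - z * cnj y)
      + takenaka a (Suc m) z * cnj (takenaka a (Suc m) y) * (1 - z * cnj y)"
    by (simp add: algebra_simps)
  also have "(\<Sum>j\<in>{1..m}. takenaka a j z * cnj (takenaka a j y)) * (1 - z * cnj y) = 1 - P z * cnj (P y)"
    unfolding P_def using Suc by auto
  also have "takenaka a (Suc m) z * cnj (takenaka a (Suc m) y) * (1 - z * cnj y)
      = P z * cnj (P y) * (of_real (1 - (cmod a')\<^sup>2) * (1 - z * cnj y) / ((1 - cnj a' * z) * cnj (1 - cnj a' * y)))"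
    unfolding takenaka_def iv P_def[symmetric] a'_def[symmetric] sq[symmetric] by (simp add: mult_ac)
  also have "\<dots> = P z * cnj (P y) * (1 - blaschke_factor a' z * cnj (blaschke_factor a' y))"
    unfolding a'_def by (subst blaschke_factor_kernel) (use Suc.prems in auto)
  finally show ?case by (simp add: P_def a'_def algebra_simps)
qed simp

locale blaschke =
  fixes m :: nat and a :: "nat \<Rightarrow> complex" and c :: complex
  assumes m: "1 \<le> m" and a: "\<And>j. j \<in> {1..m} \<Longrightarrow> cmod (a j) < 1" and c: "cmod c = 1"
begin

definition B :: "complex \<Rightarrow> complex" where
  "B z = c * (\<Prod>j\<in>{1..m}. blaschke_factor (a j) z)"

text \<open>The poles of B and of the basis lie at \<open>1 / cnj (a j)\<close> for nonzero
  \<open>a j\<close>. With \<mu> the largest modulus of a zero, \<open>1 / radius\<close> is the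
  midpoint of \<mu> and 1, so \<open>radius\<close> exceeds 1, stays below the poles and makes sense
  for \<mu> = 0.\<close>

definition radius :: real where
  "radius = 2 / (1 + Max ((\<lambda>j. cmod (a j)) ` {1..m}))"

lemma radius_gt_1: "1 < radius"
  and denominator_nonzero: "j \<in> {1..m} \<Longrightarrow> z \<in> ball 0 radius \<Longrightarrow> 1 - cnj (a j) * z \<noteq> 0"
proof -
  define \<mu> where "\<mu> = Max ((\<lambda>j. cmod (a j)) ` {1..m})"
  have ne: "(\<lambda>j. cmod (a j)) ` {1..m} \<noteq> {}" using m by auto
  have mu: "\<mu> < 1" unfolding \<mu>_def using ne a by (subst Max_less_iff) auto
  have le: "cmod (a j) \<le> \<mu>" if "j \<in> {1..m}" for j unfolding \<mu>_def using that by (intro Max_ge) auto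
  have mu0: "0 \<le> \<mu>" using le[of 1] m norm_ge_zero[of "a 1"] by (simp del: norm_ge_zero)
  show "1 < radius" unfolding radius_def \<mu>_def[symmetric] using mu mu0 by (simp add: field_simps)
  assume j: "j \<in> {1..m}" and z: "z \<in> ball 0 radius"
  have "cmod (cnj (a j) * z) \<le> \<mu> * radius"
    unfolding norm_mult complex_mod_cnj using j z mu0 by (intro mult_mono le) auto
  also have "\<dots> < 1" unfolding radius_def \<mu>_def[symmetric] using mu mu0 by (simp add: field_simps)
  finally show "1 - cnj (a j) * z \<noteq> 0" by auto
qed

lemma holomorphic_blaschke_factor: "j \<in> {1..m} \<Longrightarrow> blaschke_factor (a j) holomorphic_on ball 0 radius"
  unfolding blaschke_factor_def using denominator_nonzero by (auto intro!: holomorphic_intros)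

lemma holomorphic_B: "B holomorphic_on ball 0 radius"
  unfolding B_def by (intro holomorphic_intros holomorphic_blaschke_factor)

lemma holomorphic_takenaka: "j \<in> {1..m} \<Longrightarrow> takenaka a j holomorphic_on ball 0 radius"
  unfolding takenaka_def using denominator_nonzero
  by (intro holomorphic_intros holomorphic_blaschke_factor) auto

lemma kernel:
  assumes "z \<in> ball 0 radius" "y \<in> ball 0 radius"
  shows "(\<Sum>j\<in>{1..m}. takenaka a j z * cnj (takenaka a j y)) * (1 - z * cnj y) = 1 - B z * cnj (B y)"
proof -
  have "c * cnj c = 1" using c by (simp flip: complex_norm_square)
  hence "B z * cnj (B y) = (\<Prod>i\<in>{1..m}. blaschke_factor (a i) z) * cnj (\<Prod>i\<in>{1..m}. blaschke_factor (a i) y)"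
    unfolding B_def by (simp add: algebra_simps)
  thus ?thesis using takenaka_kernel[of m a z y] denominator_nonzero a assms by simp
qed

lemma kernel_diagonal:
  assumes "z \<in> ball 0 radius"
  shows "(\<Sum>j\<in>{1..m}. (cmod (takenaka a j z))\<^sup>2) * (1 - (cmod z)\<^sup>2) = 1 - (cmod (B z))\<^sup>2"
proof -
  have "complex_of_real ((\<Sum>j\<in>{1..m}. (cmod (takenaka a j z))\<^sup>2) * (1 - (cmod z)\<^sup>2))
      = of_real (1 - (cmod (B z))\<^sup>2)"
    unfolding of_real_mult of_real_diff of_real_sum complex_norm_square of_real_1 by (rule kernel[OF assms assms])
  thus ?thesis by (simp only: of_real_eq_iff)
qed

text \<open>On the diagonal the kernel is a sum of squares, so its sign gives the bound, on the
  circle as well, without the maximum principle.\<close>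

lemma B_le_1: "cmod z \<le> 1 \<Longrightarrow> cmod (B z) \<le> 1"
proof -
  assume z: "cmod z \<le> 1"
  have "0 \<le> (\<Sum>j\<in>{1..m}. (cmod (takenaka a j z))\<^sup>2) * (1 - (cmod z)\<^sup>2)"
    using z by (intro mult_nonneg_nonneg sum_nonneg) (auto simp: abs_square_le_1)
  also have "\<dots> = 1 - (cmod (B z))\<^sup>2" using z radius_gt_1 by (intro kernel_diagonal) auto
  finally show ?thesis by (simp add: abs_square_le_1)
qed

lemma B_less_1: "cmod z < 1 \<Longrightarrow> cmod (B z) < 1"
proof -
  assume z: "cmod z < 1"
  have zr: "z \<in> ball 0 radius" using z radius_gt_1 by auto
  have "(cmod (a 1))\<^sup>2 < 1" using a[of 1] m by (simp add: abs_square_less_1)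
  \<comment> \<open>The first basis function has an empty product and hence no zeros; it makes the
    diagonal sum strictly positive.\<close>
  hence "takenaka a 1 z \<noteq> 0" unfolding takenaka_def using denominator_nonzero[of 1 z] zr m by auto
  hence "0 < (\<Sum>j\<in>{1..m}. (cmod (takenaka a j z))\<^sup>2)"
    using m by (intro sum_pos2[of _ 1]) auto
  hence "0 < (\<Sum>j\<in>{1..m}. (cmod (takenaka a j z))\<^sup>2) * (1 - (cmod z)\<^sup>2)"
    using z by (intro mult_pos_pos) (auto simp: abs_square_less_1)
  also have "\<dots> = 1 - (cmod (B z))\<^sup>2" by (intro kernel_diagonal zr)
  finally show ?thesis by (simp add: abs_square_less_1)
qed

section \<open>Size and orthogonality of the matrix entries\<close>

definition entry :: "nat \<Rightarrow> nat \<Rightarrow> nat \<Rightarrow> complex" where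
  "entry j k n = taylor_coeff (\<lambda>z. takenaka a j z * B z ^ n) k"

lemma holomorphic_basis:
  "j \<in> {1..m} \<Longrightarrow> (\<lambda>z. takenaka a j z * B z ^ n) holomorphic_on ball 0 radius"
  by (intro holomorphic_intros holomorphic_takenaka holomorphic_B)

text \<open>Compactness gives s < 1 on a small disk, and continuity keeps the modulus of B below a
  given S > 1 on a disk slightly larger than the unit disk. The coupling \<open>s * S < 1\<close>
  makes products of the two kinds of bounds summable over the powers of B, as
  \<open>synthesis_analysis\<close> needs.\<close>

lemma basis_bounds:
  obtains M s S R where "0 < M" "0 < s" "s < 1" "1 < S" "1 < R" "s * S < 1"
    "\<And>z. z \<in> cball 0 (1/2) \<Longrightarrow> cmod (B z) \<le> s"
    "\<And>z. z \<in> cball 0 R \<Longrightarrow> cmod (B z) \<le> S"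
    "\<And>j z. j \<in> {1..m} \<Longrightarrow> z \<in> cball 0 R \<Longrightarrow> cmod (takenaka a j z) \<le> M"
    "cball (0::complex) R \<subseteq> ball 0 radius"
proof -
  have contB: "continuous_on (ball 0 radius) (\<lambda>z. cmod (B z))"
    by (intro continuous_intros holomorphic_on_imp_continuous_on holomorphic_B)
  have sub: "cball (0::complex) 1 \<subseteq> ball 0 radius" using radius_gt_1 by auto
  have "\<exists>x\<in>cball 0 (1/2). \<forall>z\<in>cball 0 (1/2). cmod (B z) \<le> cmod (B x)"
    using sub by (intro continuous_attains_sup continuous_on_subset[OF contB]) auto
  then obtain x where x: "x \<in> cball 0 (1/2)" "\<And>z. z \<in> cball 0 (1/2) \<Longrightarrow> cmod (B z) \<le> cmod (B x)"
    by blast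
  \<comment> \<open>The maximum with 1/2 makes s positive without a look at the zeros of B.\<close>
  define s where "s = max (cmod (B x)) (1/2)"
  have s: "0 < s" "s < 1" using B_less_1[of x] x(1) by (auto simp: s_def)
  \<comment> \<open>\<open>1 / S\<close> is the midpoint of s and 1, which gives both
    \<open>1 < S\<close> and \<open>s * S < 1\<close>.\<close>
  define S where "S = 2 / (1 + s)"
  have S: "1 < S" "s * S < 1" using s by (auto simp: S_def field_simps)
  have "open (ball 0 radius \<inter> (\<lambda>z. cmod (B z)) -` {..<S})"
    by (intro continuous_open_preimage contB) auto
  moreover have "cball (0::complex) 1 \<subseteq> ball 0 radius \<inter> (\<lambda>z. cmod (B z)) -` {..<S}"
  proof
    fix z :: complex assume "z \<in> cball 0 1"
    thus "z \<in> ball 0 radius \<inter> (\<lambda>z. cmod (B z)) -` {..<S}" using sub B_le_1[of z] S(1) by auto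
  qed
  ultimately obtain \<epsilon> where e: "\<epsilon> > 0" "(\<Union>x\<in>cball 0 1. cball x \<epsilon>) \<subseteq> ball 0 radius \<inter> (\<lambda>z. cmod (B z)) -` {..<S}"
    using compact_subset_open_imp_cball_epsilon_subset[OF compact_cball] by metis
  define R where "R = 1 + \<epsilon>"
  \<comment> \<open>Dividing by R takes a point of the larger disk into the unit disk and moves it
    by at most \<epsilon>.\<close>
  have "cball (0::complex) R \<subseteq> (\<Union>x\<in>cball 0 1. cball x \<epsilon>)"
  proof
    fix z :: complex assume z: "z \<in> cball 0 R"
    show "z \<in> (\<Union>x\<in>cball 0 1. cball x \<epsilon>)"
    proof (rule UN_I[of "z / of_real R"])
      show "z / of_real R \<in> cball 0 1" using z e(1) by (simp add: R_def norm_divide del: of_real_add)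
      have "z / of_real R - z = z / of_real R * of_real (- \<epsilon>)"
      proof -
        have "complex_of_real R \<noteq> 0" using e(1) by (simp add: R_def del: of_real_add)
        hence "z / of_real R - z = z / of_real R * (1 - of_real R)" by (simp add: field_simps)
        also have "1 - of_real R = complex_of_real (- \<epsilon>)" by (simp add: R_def)
        finally show ?thesis .
      qed
      hence "dist (z / of_real R) z = cmod z / R * \<epsilon>"
        using e(1) by (simp only: dist_norm norm_mult norm_divide norm_of_real) (simp add: R_def)
      also have "\<dots> \<le> 1 * \<epsilon>" using z e(1) by (intro mult_right_mono) (auto simp: R_def)
      finally show "z \<in> cball (z / of_real R) \<epsilon>" by simp
    qed
  qed
  hence R: "cball 0 R \<subseteq> ball 0 radius \<inter> (\<lambda>z. cmod (B z)) -` {..<S}" using e(2) by blast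
  have "\<exists>M. \<forall>z\<in>cball 0 R. cmod (takenaka a j z) \<le> M" if "j \<in> {1..m}" for j
  proof -
    have "continuous_on (cball 0 R) (takenaka a j)"
      using R by (intro holomorphic_on_imp_continuous_on holomorphic_on_subset[OF holomorphic_takenaka] that) auto
    hence "bounded (takenaka a j ` cball 0 R)"
      by (intro compact_imp_bounded compact_continuous_image) auto
    thus ?thesis by (auto simp: bounded_iff)
  qed
  then obtain M where M: "\<And>j z. j \<in> {1..m} \<Longrightarrow> z \<in> cball 0 R \<Longrightarrow> cmod (takenaka a j z) \<le> M j"
    by metis
  show thesis
  proof (rule that[of "(\<Sum>j\<in>{1..m}. \<bar>M j\<bar>) + 1" s S R])
    show "0 < (\<Sum>j\<in>{1..m}. \<bar>M j\<bar>) + 1" by (rule add_nonneg_pos) (auto intro: sum_nonneg)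
    show "cmod (takenaka a j z) \<le> (\<Sum>j\<in>{1..m}. \<bar>M j\<bar>) + 1" if "j \<in> {1..m}" "z \<in> cball 0 R" for j z
      using M[OF that] member_le_sum[of j "{1..m}" "\<lambda>j. \<bar>M j\<bar>"] that(1) by force
    show "1 < R" using e(1) by (simp add: R_def)
    show "cmod (B z) \<le> s" if "z \<in> cball 0 (1/2)" for z using x(2)[OF that] by (simp add: s_def)
    show "cmod (B z) \<le> S" if "z \<in> cball 0 R" for z using R that by auto
    show "cball (0::complex) R \<subseteq> ball 0 radius" using R by auto
  qed (fact s S)+
qed

text \<open>Cauchy estimates on the circles of radius 1/2 and R: the first is small when n is large
  against k, the second when k is large against n.\<close>

lemma entry_bounds:
  obtains M s S R where "0 < M" "0 < s" "s < 1" "1 < S" "1 < R" "s * S < 1"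
    "\<And>j n z. j \<in> {1..m} \<Longrightarrow> z \<in> cball 0 (1/2) \<Longrightarrow> cmod (takenaka a j z * B z ^ n) \<le> M * s ^ n"
    "\<And>j k n. j \<in> {1..m} \<Longrightarrow> cmod (entry j k n) \<le> M * s ^ n * 2 ^ k"
    "\<And>j k n. j \<in> {1..m} \<Longrightarrow> cmod (entry j k n) \<le> M * S ^ n / R ^ k"
proof -
  obtain M s S R where *: "0 < M" "0 < s" "s < 1" "1 < S" "1 < R" "s * S < 1"
    and Bs: "\<And>z. z \<in> cball 0 (1/2) \<Longrightarrow> cmod (B z) \<le> s"
    and BS: "\<And>z. z \<in> cball 0 R \<Longrightarrow> cmod (B z) \<le> S"
    and M: "\<And>j z. j \<in> {1..m} \<Longrightarrow> z \<in> cball 0 R \<Longrightarrow> cmod (takenaka a j z) \<le> M"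
    and R: "cball (0::complex) R \<subseteq> ball 0 radius"
    using basis_bounds by blast
  have sm: "cmod (takenaka a j z * B z ^ n) \<le> M * s ^ n" if "j \<in> {1..m}" "z \<in> cball 0 (1/2)" for j n z
    unfolding norm_mult norm_power using that * by (intro mult_mono power_mono Bs M) auto
  have la: "cmod (takenaka a j z * B z ^ n) \<le> M * S ^ n" if "j \<in> {1..m}" "z \<in> cball 0 R" for j n z
    unfolding norm_mult norm_power using that * by (intro mult_mono power_mono BS M) auto
  have "cmod (entry j k n) \<le> M * s ^ n / (1/2) ^ k" if "j \<in> {1..m}" for j k n
    unfolding entry_def using radius_gt_1
    by (intro taylor_coeff_bound sm holomorphic_on_subset[OF holomorphic_basis] that) auto
  moreover have "cmod (entry j k n) \<le> M * S ^ n / R ^ k" if "j \<in> {1..m}" for j k n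
    unfolding entry_def using *
    by (intro taylor_coeff_bound la[OF that] holomorphic_on_subset[OF holomorphic_basis[OF that] R]) auto
  ultimately show thesis by (intro that[OF * sm]) (auto simp: power_divide)
qed

lemma entry_decay:
  obtains M \<rho> L where "0 \<le> M" "0 < \<rho>" "\<rho> < 1"
    "\<And>j k n. j \<in> {1..m} \<Longrightarrow> L * Suc n \<le> Suc k \<or> L * Suc k \<le> Suc n \<Longrightarrow>
        cmod (entry j k n) \<le> M * \<rho> ^ (k + n)"
proof -
  obtain M s S R where *: "0 < M" "0 < s" "s < 1" "1 < S" "1 < R" "s * S < 1"
    and es: "\<And>j k n. j \<in> {1..m} \<Longrightarrow> cmod (entry j k n) \<le> M * s ^ n * 2 ^ k"
    and eS: "\<And>j k n. j \<in> {1..m} \<Longrightarrow> cmod (entry j k n) \<le> M * S ^ n / R ^ k"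
    using entry_bounds by metis
  \<comment> \<open>The square root splits the exponential decay in two: one factor
    \<open>\<rho> ^ k\<close> or \<open>\<rho> ^ n\<close> absorbs the growing power of S or 2, the
    other remains.\<close>
  define \<rho> where "\<rho> = sqrt (max s (1 / R))"
  have r: "0 < \<rho>" "\<rho> < 1" using * by (auto simp: \<rho>_def less_max_iff_disj)
  have r2: "\<rho> * \<rho> = max s (1 / R)" using * by (simp add: \<rho>_def le_max_iff_disj)
  have scale: "\<exists>L. \<forall>k n. L * Suc n \<le> Suc k \<longrightarrow> \<rho> ^ k * T ^ n \<le> \<rho> ^ n" if T: "1 \<le> T" for T
  proof -
    have "0 < \<rho> / T" "\<rho> / T < 1" using r T by (auto simp: field_simps)
    then obtain L where L: "\<rho> ^ L < \<rho> / T" using real_arch_pow_inv[of "\<rho> / T" \<rho>] r by blast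
    \<comment> \<open>A positive L turns \<open>L * Suc n \<le> Suc k\<close> into
      \<open>L * n \<le> k\<close>.\<close>
    hence "L \<noteq> 0" using \<open>\<rho> / T < 1\<close> by (intro notI) auto
    have "\<rho> ^ k * T ^ n \<le> \<rho> ^ n" if "L * Suc n \<le> Suc k" for k n
    proof -
      have "L * n \<le> k" using that \<open>L \<noteq> 0\<close> by simp
      hence "\<rho> ^ k \<le> (\<rho> ^ L) ^ n" using r by (simp add: power_decreasing flip: power_mult)
      also have "\<dots> \<le> (\<rho> / T) ^ n" using L r by (intro power_mono) auto
      finally show ?thesis using T by (simp add: power_divide field_simps)
    qed
    thus ?thesis by blast
  qed
  obtain L1 where L1: "\<And>k n. L1 * Suc n \<le> Suc k \<Longrightarrow> \<rho> ^ k * S ^ n \<le> \<rho> ^ n" using scale[of S] * by auto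
  obtain L2 where L2: "\<And>k n. L2 * Suc n \<le> Suc k \<Longrightarrow> \<rho> ^ k * 2 ^ n \<le> \<rho> ^ n" using scale[of 2] by auto
  show thesis
  proof (rule that[of M \<rho> "max L1 L2"])
    fix j k n assume j: "j \<in> {1..m}" and "max L1 L2 * Suc n \<le> Suc k \<or> max L1 L2 * Suc k \<le> Suc n"
    thus "cmod (entry j k n) \<le> M * \<rho> ^ (k + n)"
    proof (elim disjE)
      assume "max L1 L2 * Suc n \<le> Suc k"
      hence l: "L1 * Suc n \<le> Suc k" by (rule order_trans[rotated]) (intro mult_right_mono, auto)
      have "(1 / R) ^ k \<le> (\<rho> * \<rho>) ^ k" unfolding r2 using * by (intro power_mono) auto
      hence "M * S ^ n * (1 / R) ^ k \<le> M * S ^ n * (\<rho> ^ k * \<rho> ^ k)"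
        using * by (intro mult_left_mono) (auto simp: power_mult_distrib)
      also have "\<dots> = M * \<rho> ^ k * (\<rho> ^ k * S ^ n)" by simp
      also have "\<dots> \<le> M * \<rho> ^ k * \<rho> ^ n" using * r by (intro mult_left_mono L1 l) auto
      finally show ?thesis using eS[OF j, of k n] by (simp add: power_add power_divide mult_ac)
    next
      assume "max L1 L2 * Suc k \<le> Suc n"
      hence l: "L2 * Suc k \<le> Suc n" by (rule order_trans[rotated]) (intro mult_right_mono, auto)
      have "s ^ n \<le> (\<rho> * \<rho>) ^ n" unfolding r2 using * by (intro power_mono) auto
      hence "M * 2 ^ k * s ^ n \<le> M * 2 ^ k * (\<rho> ^ n * \<rho> ^ n)"
        using * by (intro mult_left_mono) (auto simp: power_mult_distrib)
      also have "\<dots> = M * \<rho> ^ n * (\<rho> ^ n * 2 ^ k)" by simp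
      also have "\<dots> \<le> M * \<rho> ^ n * \<rho> ^ k" using * r by (intro mult_left_mono L2 l) auto
      finally show ?thesis using es[OF j, of k n] by (simp add: power_add mult_ac)
    qed
  qed (use * r in auto)
qed

text \<open>Comparing Taylor coefficients in both variables of the expansion
  \<open>1 / (1 - z cnj y) = (\<Sum>n. \<Sum>j. e\<^sub>j(z) B(z)\<^sup>n cnj (e\<^sub>j(y) B(y)\<^sup>n))\<close>, a consequence of \<open>kernel\<close>.\<close>

lemma entry_coisometry:
  "(\<lambda>n. \<Sum>j\<in>{1..m}. entry j k n * cnj (entry j l n)) sums (if k = l then 1 else 0)"
proof -
  obtain M s where *: "0 < M" "0 < s" "s < 1"
    and bs: "\<And>j n z. j \<in> {1..m} \<Longrightarrow> z \<in> cball 0 (1/2) \<Longrightarrow> cmod (takenaka a j z * B z ^ n) \<le> M * s ^ n"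
    and es: "\<And>j k n. j \<in> {1..m} \<Longrightarrow> cmod (entry j k n) \<le> M * s ^ n * 2 ^ k"
    using entry_bounds by metis
  define g where "g j n z = takenaka a j z * B z ^ n" for j n z
  have ball: "ball (0::complex) (1/2) \<subseteq> ball 0 radius" using radius_gt_1 by auto
  have hol: "g j n holomorphic_on ball 0 (1/2)" if "j \<in> {1..m}" for j n
    unfolding g_def by (rule holomorphic_on_subset[OF holomorphic_basis[OF that] ball])
  have gb: "cmod (g j n z) \<le> M * s ^ n" if "j \<in> {1..m}" "z \<in> ball 0 (1/2)" for j n z
    unfolding g_def using that by (intro bs) auto
  have tg: "taylor_coeff (g j n) k = entry j k n" for j k n unfolding g_def entry_def ..
  have gb1: "cmod (g j n z) \<le> M" if "j \<in> {1..m}" "z \<in> ball 0 (1/2)" for j n z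
  proof -
    have "M * s ^ n \<le> M * 1" using * by (intro mult_left_mono power_le_one) auto
    thus ?thesis using gb[OF that, of n] by linarith
  qed
  have sg: "summable (\<lambda>n. C * s ^ n)" for C using * by (intro summable_mult summable_geometric) auto
  \<comment> \<open>The geometric series in \<open>B z * cnj (B y)\<close>, multiplied by the kernel
    identity. The radius 1/2 supplies the majorants \<open>s ^ n\<close> used below.\<close>
  have repr: "(\<lambda>n. \<Sum>j\<in>{1..m}. cnj (g j n y) * g j n z) sums (1 / (1 - z * cnj y))"
    if zy: "z \<in> ball 0 (1/2)" "y \<in> ball 0 (1/2)" for z y
  proof -
    have "cmod (z * cnj y) < 1" using zy mult_strict_mono'[of "cmod z" 1 "cmod y" 1] by (simp add: norm_mult)
    hence nz: "1 - z * cnj y \<noteq> 0" by auto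
    have BB: "cmod (B z * cnj (B y)) < 1"
      using B_less_1[of z] B_less_1[of y] zy mult_strict_mono'[of "cmod (B z)" 1 "cmod (B y)" 1]
      by (simp add: norm_mult)
    hence nz2: "1 - B z * cnj (B y) \<noteq> 0" by auto
    define E where "E = (\<Sum>j\<in>{1..m}. takenaka a j z * cnj (takenaka a j y))"
    have E: "E * (1 - z * cnj y) = 1 - B z * cnj (B y)"
      unfolding E_def using zy ball by (intro kernel) auto
    have "(\<lambda>n. E * (B z * cnj (B y)) ^ n) sums (E * (1 / (1 - B z * cnj (B y))))"
      by (intro sums_mult geometric_sums BB)
    also have "E * (1 / (1 - B z * cnj (B y))) = 1 / (1 - z * cnj y)"
      using E nz nz2 by (simp add: divide_simps)
    also have "(\<lambda>n. E * (B z * cnj (B y)) ^ n) = (\<lambda>n. \<Sum>j\<in>{1..m}. cnj (g j n y) * g j n z)"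
      by (simp add: E_def g_def sum_distrib_right sum_distrib_left power_mult_distrib mult_ac)
    finally show ?thesis .
  qed
  \<comment> \<open>Coefficients in z are compared with y fixed; one factor of each term carries the
    majorant, the other is bounded by M.\<close>
  have step1: "(\<lambda>n. \<Sum>j\<in>{1..m}. cnj (g j n y) * entry j k n) sums (cnj y ^ k)"
    if y: "y \<in> ball 0 (1/2)" for y k
  proof -
    have "(\<lambda>n. taylor_coeff (\<lambda>z. \<Sum>j\<in>{1..m}. cnj (g j n y) * g j n z) k)
        sums taylor_coeff (\<lambda>z. \<Sum>n. \<Sum>j\<in>{1..m}. cnj (g j n y) * g j n z) k"
    proof (rule taylor_coeff_suminf)
      fix n and z :: complex assume z: "z \<in> ball 0 (1/2)"
      show "cmod (\<Sum>j\<in>{1..m}. cnj (g j n y) * g j n z) \<le> (real m * M * M) * s ^ n"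
      proof -
        have "cmod (\<Sum>j\<in>{1..m}. cnj (g j n y) * g j n z) \<le> (\<Sum>j\<in>{1..m}. M * (M * s ^ n))"
          unfolding norm_mult complex_mod_cnj
          by (intro sum_norm_le) (use * in \<open>auto simp: norm_mult intro!: mult_mono gb1[OF _ y] gb[OF _ z]\<close>)
        thus ?thesis by (simp add: mult_ac)
      qed
    qed (use sg in \<open>auto intro!: holomorphic_intros hol simp del: summable_cmult_iff\<close>)
    also have "taylor_coeff (\<lambda>z. \<Sum>n. \<Sum>j\<in>{1..m}. cnj (g j n y) * g j n z) = (\<lambda>k. cnj y ^ k)"
    proof (rule taylor_coeff_unique)
      fix z :: complex assume z: "z \<in> ball 0 (1/2)"
      have "cmod (cnj y * z) < 1" using z y mult_strict_mono'[of "cmod z" 1 "cmod y" 1]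
        by (simp add: norm_mult mult.commute)
      hence "(\<lambda>k. (cnj y * z) ^ k) sums (1 / (1 - cnj y * z))" by (rule geometric_sums)
      thus "(\<lambda>k. cnj y ^ k * z ^ k) sums (\<Sum>n. \<Sum>j\<in>{1..m}. cnj (g j n y) * g j n z)"
        using sums_unique[OF repr[OF z y]] by (simp add: power_mult_distrib mult.commute)
    qed simp
    finally show ?thesis
      by (subst (asm) taylor_coeff_linear[of "1/2"]) (auto simp: hol tg)
  qed
  have "(\<lambda>n. taylor_coeff (\<lambda>y. \<Sum>j\<in>{1..m}. cnj (entry j l n) * g j n y) k)
        sums taylor_coeff (\<lambda>y. \<Sum>n. \<Sum>j\<in>{1..m}. cnj (entry j l n) * g j n y) k"
  proof (rule taylor_coeff_suminf)
    fix n and z :: complex assume z: "z \<in> ball 0 (1/2)"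
    show "cmod (\<Sum>j\<in>{1..m}. cnj (entry j l n) * g j n z) \<le> (real m * M * M * 2 ^ l) * s ^ n"
    proof -
      have "cmod (\<Sum>j\<in>{1..m}. cnj (entry j l n) * g j n z) \<le> (\<Sum>j\<in>{1..m}. M * s ^ n * 2 ^ l * M)"
        by (intro sum_norm_le) (use * in \<open>auto simp: norm_mult intro!: mult_mono gb1[OF _ z] es\<close>)
      thus ?thesis by (simp add: mult_ac)
    qed
  qed (use sg in \<open>auto intro!: holomorphic_intros hol simp del: summable_cmult_iff\<close>)
  also have "taylor_coeff (\<lambda>y. \<Sum>n. \<Sum>j\<in>{1..m}. cnj (entry j l n) * g j n y) = (\<lambda>k. if k = l then 1 else 0)"
  proof (rule taylor_coeff_unique)
    fix y :: complex assume y: "y \<in> ball 0 (1/2)"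
    \<comment> \<open>The series of \<open>step1\<close> is antiholomorphic in y; conjugating it
      makes its coefficients in y accessible.\<close>
    have "(\<lambda>n. cnj (\<Sum>j\<in>{1..m}. cnj (g j n y) * entry j l n)) sums cnj (cnj y ^ l)"
      by (subst sums_cnj) (rule step1[OF y])
    hence "(\<Sum>n. \<Sum>j\<in>{1..m}. cnj (entry j l n) * g j n y) = y ^ l"
      by (intro sums_unique[symmetric]) (simp add: mult.commute)
    moreover have "(\<lambda>k. (if k = l then y ^ k else 0)) sums y ^ l" by (rule sums_single)
    ultimately show "(\<lambda>k. (if k = l then 1 else 0) * y ^ k) sums (\<Sum>n. \<Sum>j\<in>{1..m}. cnj (entry j l n) * g j n y)"
      by (simp add: if_distrib[of "\<lambda>t. t * _"] cong: if_cong)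
  qed simp
  finally show ?thesis
    by (subst (asm) taylor_coeff_linear[of "1/2"]) (auto simp: hol tg mult.commute)
qed

text \<open>Orthonormal rows make the transposed matrix, over all copies together, an isometry on
  finite vectors y; keeping a single copy and finitely many columns only decreases the norm.\<close>

lemma form_bounded_entry:
  assumes j: "j \<in> {1..m}"
  shows "form_bounded (entry j) 1"
  unfolding form_bounded_def
proof (intro conjI allI impI)
  fix A A' :: "nat set" and x y :: "nat \<Rightarrow> complex"
  assume fin: "finite A" "finite A'"
  define v where "v i n = (\<Sum>k\<in>A. y k * entry i k n)" for i n
  have "(\<lambda>n. \<Sum>k\<in>A. \<Sum>l\<in>A. y k * cnj (y l) * (\<Sum>i\<in>{1..m}. entry i k n * cnj (entry i l n)))
      sums (\<Sum>k\<in>A. \<Sum>l\<in>A. y k * cnj (y l) * (if k = l then 1 else 0))"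
    by (intro sums_sum sums_mult entry_coisometry)
  also have "(\<Sum>k\<in>A. \<Sum>l\<in>A. y k * cnj (y l) * (if k = l then 1 else 0)) = of_real (\<Sum>k\<in>A. (cmod (y k))\<^sup>2)"
    using fin by (simp add: if_distrib[of "\<lambda>t. _ * t"] complex_norm_square[symmetric] cong: if_cong del: of_real_power)
  also have "(\<lambda>n. \<Sum>k\<in>A. \<Sum>l\<in>A. y k * cnj (y l) * (\<Sum>i\<in>{1..m}. entry i k n * cnj (entry i l n)))
      = (\<lambda>n. of_real (\<Sum>i\<in>{1..m}. (cmod (v i n))\<^sup>2))"
  proof
    fix n
    have "of_real (\<Sum>i\<in>{1..m}. (cmod (v i n))\<^sup>2) = (\<Sum>i\<in>{1..m}. v i n * cnj (v i n))"
      by (simp add: complex_norm_square del: of_real_power)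
    also have "\<dots> = (\<Sum>i\<in>{1..m}. \<Sum>k\<in>A. \<Sum>l\<in>A. y k * cnj (y l) * (entry i k n * cnj (entry i l n)))"
      by (simp add: v_def sum_product mult_ac)
    also have "\<dots> = (\<Sum>k\<in>A. \<Sum>l\<in>A. \<Sum>i\<in>{1..m}. y k * cnj (y l) * (entry i k n * cnj (entry i l n)))"
      by (subst sum.swap) (intro sum.cong refl sum.swap)
    finally show "(\<Sum>k\<in>A. \<Sum>l\<in>A. y k * cnj (y l) * (\<Sum>i\<in>{1..m}. entry i k n * cnj (entry i l n)))
        = of_real (\<Sum>i\<in>{1..m}. (cmod (v i n))\<^sup>2)" by (simp add: sum_distrib_left)
  qed
  finally have sm: "(\<lambda>n. \<Sum>i\<in>{1..m}. (cmod (v i n))\<^sup>2) sums (\<Sum>k\<in>A. (cmod (y k))\<^sup>2)"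
    by (simp only: sums_of_real_iff)
  have "(\<Sum>n\<in>A'. (cmod (v j n))\<^sup>2) \<le> (\<Sum>n\<in>A'. \<Sum>i\<in>{1..m}. (cmod (v i n))\<^sup>2)"
    by (intro sum_mono member_le_sum j) auto
  also have "\<dots> \<le> (\<Sum>k\<in>A. (cmod (y k))\<^sup>2)"
    unfolding sums_unique[OF sm] using sm fin
    by (intro sum_le_suminf) (auto intro: sums_summable sum_nonneg)
  finally have contr: "L2_set (\<lambda>n. cmod (v j n)) A' \<le> L2_set (\<lambda>k. cmod (y k)) A"
    unfolding L2_set_def by (rule real_sqrt_le_mono)
  have "(\<Sum>k\<in>A. \<Sum>n\<in>A'. y k * entry j k n * x n) = (\<Sum>n\<in>A'. v j n * x n)"
    by (subst sum.swap) (simp add: v_def sum_distrib_right)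
  also have "cmod \<dots> \<le> (\<Sum>n\<in>A'. \<bar>cmod (v j n)\<bar> * \<bar>cmod (x n)\<bar>)"
    by (intro sum_norm_le) (simp add: norm_mult)
  also have "\<dots> \<le> L2_set (\<lambda>n. cmod (v j n)) A' * L2_set (\<lambda>n. cmod (x n)) A'"
    by (rule L2_set_mult_ineq)
  also have "\<dots> \<le> L2_set (\<lambda>k. cmod (y k)) A * L2_set (\<lambda>n. cmod (x n)) A'"
    by (intro mult_right_mono contr) simp
  finally show "cmod (\<Sum>k\<in>A. \<Sum>n\<in>A'. y k * entry j k n * x n)
     \<le> 1 * L2_set (\<lambda>k. cmod (y k)) A * L2_set (\<lambda>n. cmod (x n)) A'" by simp
qed simp

end

section \<open>Injectivity of the synthesis map\<close>

lemma vanishes_off_finite: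
  fixes f :: "complex \<Rightarrow> complex"
  assumes "continuous_on (ball 0 1) f" "finite S" "\<And>z. z \<in> ball 0 1 - S \<Longrightarrow> f z = 0" "z \<in> ball 0 1"
  shows "f z = 0"
proof -
  have "isCont f z" using assms(1,4) by (simp add: continuous_on_eq_continuous_at)
  hence "(f \<longlongrightarrow> f z) (at z)" by (simp add: isCont_def)
  moreover have "eventually (\<lambda>u. u \<in> ball 0 1 \<inter> - (S - {z}) - {z}) (at z)"
    using assms(2,4) by (intro eventually_at_in_open open_Int open_Compl finite_imp_closed) auto
  hence "eventually (\<lambda>u. f u = 0) (at z)"
    by eventually_elim (rule assms(3), auto)
  hence "(f \<longlongrightarrow> 0) (at z)" by (rule tendsto_eventually)
  ultimately show ?thesis using tendsto_unique trivial_limit_at by blast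
qed

lemma divide_by_z:
  fixes F :: "complex \<Rightarrow> complex"
  assumes "F holomorphic_on ball 0 1" "F 0 = 0"
  obtains G where "G holomorphic_on ball 0 1" "\<And>z. F z = z * G z"
proof
  show "(\<lambda>z. if z = 0 then deriv F 0 else (F z - F 0) / (z - 0)) holomorphic_on ball 0 1"
    using assms(1) by (intro pole_lemma) auto
qed (use assms in auto)

context blaschke
begin

lemma B_in_disc: "z \<in> ball 0 1 \<Longrightarrow> B z \<in> ball 0 1"
  using B_less_1[of z] by simp

lemma disc_subset: "ball 0 1 \<subseteq> ball (0::complex) radius"
  using radius_gt_1 by auto

lemma holomorphic_comp_B: "F holomorphic_on ball 0 1 \<Longrightarrow> (\<lambda>z. F (B z)) holomorphic_on ball 0 1"
  using holomorphic_on_compose_gen[OF holomorphic_on_subset[OF holomorphic_B disc_subset], of F "ball 0 1"] B_in_disc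
  by (simp add: o_def image_subset_iff)

lemma holomorphic_takenaka_comp_B:
  "j \<in> {1..m} \<Longrightarrow> F holomorphic_on ball 0 1 \<Longrightarrow>
     (\<lambda>z. takenaka a j z * F (B z)) holomorphic_on ball 0 1"
  by (intro holomorphic_intros holomorphic_comp_B holomorphic_on_subset[OF holomorphic_takenaka disc_subset])

text \<open>With \<open>j\<close> least such that \<open>F\<^sub>j(0) \<noteq> 0\<close>, all terms are divisible by the product of the first
  \<open>j - 1\<close> Blaschke factors; dividing it out and evaluating at \<open>a\<^sub>j\<close> isolates the \<open>j\<close>-th term.\<close>

lemma takenaka_independent_at_0:
  assumes hol: "\<And>j. j \<in> {1..m} \<Longrightarrow> F j holomorphic_on ball 0 1"
    and zero: "\<And>z. z \<in> ball 0 1 \<Longrightarrow> (\<Sum>j\<in>{1..m}. takenaka a j z * F j (B z)) = 0"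
    and "j \<in> {1..m}"
  shows "F j 0 = 0"
  using \<open>j \<in> {1..m}\<close>
proof (induction j rule: less_induct)
  case (less j)
  note jm = less.prems
  \<comment> \<open>By the induction hypothesis each earlier \<open>F i\<close> vanishes at 0, so
    \<open>F i (B z)\<close> contains the factor \<open>B z\<close> and with it every Blaschke
    factor.\<close>
  have "\<exists>G. G holomorphic_on ball 0 1 \<and> (\<forall>z. F i z = z * G z)" if "i \<in> {1..<j}" for i
  proof -
    have i: "i \<in> {1..m}" using that jm by auto
    have "F i 0 = 0" using less.IH[of i] that i by auto
    with hol[OF i] show ?thesis by (metis divide_by_z)
  qed
  then obtain G where G: "\<And>i. i \<in> {1..<j} \<Longrightarrow> G i holomorphic_on ball 0 1"
      "\<And>i z. i \<in> {1..<j} \<Longrightarrow> F i z = z * G i z"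
    by metis
  define n where "n i z = of_real (sqrt (1 - (cmod (a i))\<^sup>2)) / (1 - cnj (a i) * z)" for i z
  define P where "P S z = (\<Prod>i\<in>S. blaschke_factor (a i) z)" for S z
  \<comment> \<open>Quotients by the first j Blaschke factors: earlier terms have these factors from
    B, later terms from their own product in \<open>takenaka\<close>. Only the j-th term lacks the
    j-th factor.\<close>
  define h where "h z = (\<Sum>i\<in>{1..<j}. takenaka a i z * (c * P {j<..m} z * G i (B z)))
      + (\<Sum>i\<in>{j<..m}. n i z * P {j<..<i} z * F i (B z))" for z
  define k where "k z = n j z * F j (B z) + blaschke_factor (a j) z * h z" for z
  have holn: "n i holomorphic_on ball 0 1" if "i \<in> {1..m}" for i
    unfolding n_def using denominator_nonzero[OF that] disc_subset by (auto intro!: holomorphic_intros)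
  have holb: "blaschke_factor (a i) holomorphic_on ball 0 1" if "i \<in> {1..m}" for i
    by (rule holomorphic_on_subset[OF holomorphic_blaschke_factor[OF that] disc_subset])
  have holP: "P S holomorphic_on ball 0 1" if "S \<subseteq> {1..m}" for S
    unfolding P_def using that by (intro holomorphic_intros holb) auto
  have "h holomorphic_on ball 0 1"
    unfolding h_def using jm
    by (intro holomorphic_intros holP holn holomorphic_comp_B G hol
          holomorphic_on_subset[OF holomorphic_takenaka disc_subset]) auto
  hence holk: "k holomorphic_on ball 0 1"
    unfolding k_def using jm by (intro holomorphic_intros holn holb holomorphic_comp_B hol) auto
  have tk: "takenaka a i z = n i z * P {1..<i} z" for i z
    by (simp add: takenaka_def n_def P_def)
  have Psplit: "P (insert j ({1..<j} \<union> S)) z = P {1..<j} z * blaschke_factor (a j) z * P S z"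
    if "S \<subseteq> {j<..m}" for S z
    unfolding P_def using that finite_subset[OF that]
    by (subst prod.insert, force, force, subst prod.union_disjoint) (force simp: mult_ac)+
  have factor: "P {1..<j} z * k z = 0" if z: "z \<in> ball 0 1" for z
  proof -
    have "{1..m} = {1..<j} \<union> insert j {j<..m}" using jm by auto
    hence "(\<Sum>i\<in>{1..m}. takenaka a i z * F i (B z)) = (\<Sum>i\<in>{1..<j}. takenaka a i z * F i (B z))
        + (takenaka a j z * F j (B z) + (\<Sum>i\<in>{j<..m}. takenaka a i z * F i (B z)))"
      by (simp only: sum.union_disjoint[of "{1..<j}" "insert j {j<..m}"] finite_atLeastLessThan finite_insert
            finite_greaterThanAtMost) (subst sum.union_disjoint, auto)
    also have "(\<Sum>i\<in>{1..<j}. takenaka a i z * F i (B z))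
        = P {1..<j} z * blaschke_factor (a j) z * (\<Sum>i\<in>{1..<j}. takenaka a i z * (c * P {j<..m} z * G i (B z)))"
      unfolding sum_distrib_left
    proof (intro sum.cong refl)
      fix i assume i: "i \<in> {1..<j}"
      have iv: "{1..m} = insert j ({1..<j} \<union> {j<..m})" using jm by auto
      have "B z = c * P {1..m} z" by (simp add: B_def P_def)
      also have "P {1..m} z = P {1..<j} z * blaschke_factor (a j) z * P {j<..m} z"
        by (subst iv) (rule Psplit, simp)
      finally have Bz: "B z = c * (P {1..<j} z * blaschke_factor (a j) z * P {j<..m} z)" .
      have "F i (B z) = c * (P {1..<j} z * blaschke_factor (a j) z * P {j<..m} z) * G i (B z)"
        unfolding G(2)[OF i] using Bz by simp
      thus "takenaka a i z * F i (B z)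
        = P {1..<j} z * blaschke_factor (a j) z * (takenaka a i z * (c * P {j<..m} z * G i (B z)))"
        by simp
    qed
    also have "(\<Sum>i\<in>{j<..m}. takenaka a i z * F i (B z))
        = P {1..<j} z * blaschke_factor (a j) z * (\<Sum>i\<in>{j<..m}. n i z * P {j<..<i} z * F i (B z))"
      unfolding sum_distrib_left
    proof (intro sum.cong refl)
      fix i assume i: "i \<in> {j<..m}"
      have iv: "{1..<i} = insert j ({1..<j} \<union> {j<..<i})" using jm i by auto
      have "P {1..<i} z = P {1..<j} z * blaschke_factor (a j) z * P {j<..<i} z"
        by (subst iv) (rule Psplit, use i in auto)
      thus "takenaka a i z * F i (B z)
        = P {1..<j} z * blaschke_factor (a j) z * (n i z * P {j<..<i} z * F i (B z))"
        by (simp add: tk)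
    qed
    finally show ?thesis using zero[OF z] by (simp add: k_def h_def tk[of j] algebra_simps)
  qed
  have aj: "a j \<in> ball 0 1" using a jm by auto
  have nz: "1 - cnj (a i) * z \<noteq> 0" if "i \<in> {1..m}" "z \<in> ball 0 1" for i z
    using denominator_nonzero[OF that(1)] that(2) disc_subset by blast
  \<comment> \<open>Repeated zeros may make the divided-out product vanish at \<open>a j\<close>
    itself, so the value there is obtained by continuity.\<close>
  have "k (a j) = 0"
  proof (rule vanishes_off_finite[OF holomorphic_on_imp_continuous_on[OF holk] _ _ aj, of "a ` {1..<j}"])
    fix z assume z: "z \<in> ball 0 1 - a ` {1..<j}"
    have "P {1..<j} z \<noteq> 0"
      unfolding P_def using z nz jm by (auto simp: blaschke_factor_def)
    thus "k z = 0" using factor[of z] z by auto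
  qed simp
  moreover have "blaschke_factor (a j) (a j) = 0" by (simp add: blaschke_factor_def)
  moreover from this have "B (a j) = 0" unfolding B_def using jm by auto
  moreover have "(cmod (a j))\<^sup>2 < 1" using a[OF jm] by (simp add: abs_square_less_1)
  hence "n j (a j) \<noteq> 0" unfolding n_def using nz[OF jm aj] by simp
  ultimately show "F j 0 = 0" by (simp add: k_def)
qed

end

lemma taylor_coeff_mult_z:
  assumes "0 < r" "G holomorphic_on ball 0 r"
  shows "taylor_coeff (\<lambda>z. z * G z) = (\<lambda>k. if k = 0 then 0 else taylor_coeff G (k - 1))"
proof (rule taylor_coeff_unique[OF assms(1)])
  fix z :: complex assume z: "z \<in> ball 0 r"
  have "(\<lambda>k. z * (taylor_coeff G k * z ^ k)) sums (z * G z)"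
    by (intro sums_mult taylor_coeff_sums[OF assms(2) z])
  hence "(\<lambda>k. (if Suc k = 0 then 0 else taylor_coeff G (Suc k - 1)) * z ^ Suc k) sums (z * G z)"
    by (simp add: mult_ac)
  thus "(\<lambda>k. (if k = 0 then 0 else taylor_coeff G (k - 1)) * z ^ k) sums (z * G z)"
    by (subst (asm) sums_Suc_iff) simp
qed

text \<open>Once all constant terms vanish, \<open>F i\<close> is z times \<open>G i\<close>, and
  the relation is B times the same relation for G. Cancelling B off its finitely many zeros repeats
  the situation with coefficients shifted by one.\<close>

lemma (in blaschke) takenaka_independent:
  assumes "\<And>j. j \<in> {1..m} \<Longrightarrow> F j holomorphic_on ball 0 1"
    and "\<And>z. z \<in> ball 0 1 \<Longrightarrow> (\<Sum>j\<in>{1..m}. takenaka a j z * F j (B z)) = 0"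
    and "j \<in> {1..m}"
  shows "taylor_coeff (F j) n = 0"
  using assms
proof (induction n arbitrary: F j)
  case 0
  thus ?case using takenaka_independent_at_0[of F j] by (simp add: taylor_coeff_deriv)
next
  case (Suc n)
  have "\<exists>G. G holomorphic_on ball 0 1 \<and> (\<forall>z. F i z = z * G z)" if "i \<in> {1..m}" for i
    using Suc.prems(1)[OF that] takenaka_independent_at_0[OF Suc.prems(1,2) that] by (metis divide_by_z)
  then obtain G where G: "\<And>i. i \<in> {1..m} \<Longrightarrow> G i holomorphic_on ball 0 1"
      "\<And>i z. i \<in> {1..m} \<Longrightarrow> F i z = z * G i z"
    by metis
  define k where "k z = (\<Sum>i\<in>{1..m}. takenaka a i z * G i (B z))" for z
  have holk: "k holomorphic_on ball 0 1"
    unfolding k_def by (intro holomorphic_intros holomorphic_takenaka_comp_B G)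
  have "k z = 0" if z: "z \<in> ball 0 1" for z
  proof (rule vanishes_off_finite[OF holomorphic_on_imp_continuous_on[OF holk] _ _ z, of "a ` {1..m}"])
    fix z assume z: "z \<in> ball 0 1 - a ` {1..m}"
    hence "1 - cnj (a i) * z \<noteq> 0" if "i \<in> {1..m}" for i
      using denominator_nonzero[OF that] disc_subset by blast
    hence "B z \<noteq> 0" unfolding B_def using z c by (auto simp: blaschke_factor_def)
    moreover have "B z * k z = (\<Sum>i\<in>{1..m}. takenaka a i z * F i (B z))"
      unfolding k_def sum_distrib_left by (intro sum.cong) (auto simp: G(2))
    ultimately show "k z = 0" using Suc.prems(2)[of z] z by auto
  qed simp
  hence "taylor_coeff (G j) n = 0" using Suc.IH[of G j] G Suc.prems(3) by (simp add: k_def)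
  moreover have "F j = (\<lambda>z. z * G j z)" using G(2)[OF Suc.prems(3)] by auto
  ultimately show ?case using taylor_coeff_mult_z[of 1 "G j"] G Suc.prems(3) by simp
qed

subsection \<open>Weights of polynomial growth\<close>

lemma hardy_beta_Suc: "hardy_beta w (Suc k) = hardy_beta w k * w (Suc k)"
  by (simp add: hardy_beta_def)

text \<open>The ratio test, phrased so that it applies to \<open>hardy_beta w\<close> with ratios
  \<open>w k\<close> and to its reciprocal with ratios \<open>1 / w k\<close>.\<close>

lemma summable_power_times_ratio:
  fixes g v :: "nat \<Rightarrow> real"
  assumes "\<And>k. 0 < g k" "\<And>k. g (Suc k) = g k * v (Suc k)" "v \<longlonglongrightarrow> 1" "0 < \<rho>" "\<rho> < 1"
  shows "summable (\<lambda>k. \<rho> ^ k * g k)"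
proof -
  have "(\<lambda>k. \<rho> * v (Suc k)) \<longlonglongrightarrow> \<rho> * 1"
    by (intro tendsto_intros LIMSEQ_Suc assms(3))
  hence "eventually (\<lambda>k. \<rho> * v (Suc k) < (1 + \<rho>) / 2) sequentially"
    using assms(5) by (intro order_tendstoD) auto
  then obtain N where N: "\<And>k. k \<ge> N \<Longrightarrow> \<rho> * v (Suc k) < (1 + \<rho>) / 2"
    by (auto simp: eventually_sequentially)
  show ?thesis
  proof (rule summable_ratio_test)
    show "(1 + \<rho>) / 2 < 1" using assms(5) by simp
    fix k assume k: "N \<le> k"
    have pos: "0 < \<rho> ^ k * g k" "0 < \<rho> ^ Suc k * g (Suc k)" using assms(1,4) by auto
    have "\<rho> ^ Suc k * g (Suc k) = (\<rho> * v (Suc k)) * (\<rho> ^ k * g k)" using assms(2) by simp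
    also have "\<dots> \<le> (1 + \<rho>) / 2 * (\<rho> ^ k * g k)"
      using N[OF k] pos by (intro mult_right_mono) auto
    finally show "norm (\<rho> ^ Suc k * g (Suc k)) \<le> (1 + \<rho>) / 2 * norm (\<rho> ^ k * g k)"
      using pos by (simp only: real_norm_def abs_of_pos)
  qed
qed

lemma abs_ln_le:
  fixes x :: real
  assumes x: "1/2 \<le> x"
  shows "\<bar>ln x\<bar> \<le> 2 * \<bar>x - 1\<bar>"
proof (rule abs_leI)
  have "ln x \<le> x - 1" using x by (intro ln_le_minus_one) auto
  also have "\<dots> \<le> \<bar>x - 1\<bar>" by simp
  also have "\<dots> \<le> 2 * \<bar>x - 1\<bar>" by simp
  finally show "ln x \<le> 2 * \<bar>x - 1\<bar>" .
  have "- ln x \<le> (1 - x) / x"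
    using ln_le_minus_one[of "1 / x"] x by (simp add: ln_div diff_divide_distrib)
  also have "(1 - x) / x \<le> \<bar>1 - x\<bar> / x" using x by (intro divide_right_mono) auto
  also have "\<dots> \<le> \<bar>1 - x\<bar> / (1/2)" using x by (intro divide_left_mono) auto
  finally show "- ln x \<le> 2 * \<bar>x - 1\<bar>" by (simp add: abs_minus_commute)
qed

text \<open>For comparability, logarithms turn the product into a sum whose terms beyond index k are
  at most \<open>C / (k + 1)\<close>. A sector leaves at most \<open>L * (k + 1)\<close> of them
  between k and n, so the total is bounded by \<open>L * C\<close>.\<close>

lemma regular_weight_hardy_beta:
  assumes w: "weight_sequence w" and growth: "polynomial_growth w"
  shows "regular_weight (hardy_beta w)"
proof
  have wpos: "0 < w k" if "1 \<le> k" for k using w that by (simp add: weight_sequence_def)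
  have lim: "w \<longlonglongrightarrow> 1" using w by (simp add: weight_sequence_def)
  show pos: "0 < hardy_beta w k" for k
    unfolding hardy_beta_def using wpos by (intro prod_pos) auto
  fix \<rho> :: real assume r: "0 < \<rho>" "\<rho> < 1"
  show "summable (\<lambda>k. \<rho> ^ k * hardy_beta w k)"
    by (rule summable_power_times_ratio[OF pos hardy_beta_Suc lim r])
  have "summable (\<lambda>k. \<rho> ^ k * (1 / hardy_beta w k))"
  proof (rule summable_power_times_ratio[OF _ _ _ r])
    show "(\<lambda>k. 1 / w k) \<longlonglongrightarrow> 1" using tendsto_divide[OF tendsto_const lim, of 1] by simp
  qed (auto simp: pos hardy_beta_Suc)
  thus "summable (\<lambda>k. \<rho> ^ k / hardy_beta w k)" by simp
next
  have wpos: "0 < w k" if "1 \<le> k" for k using w that by (simp add: weight_sequence_def)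
  have lim: "w \<longlonglongrightarrow> 1" using w by (simp add: weight_sequence_def)
  have pos: "0 < hardy_beta w k" for k
    unfolding hardy_beta_def using wpos by (intro prod_pos) auto
  obtain D where D: "\<And>k. 1 \<le> k \<Longrightarrow> (real k + 1) * \<bar>w k - 1\<bar> \<le> D"
    using growth by (auto simp: polynomial_growth_def bdd_above_def)
  obtain N where N: "\<And>k. N \<le> k \<Longrightarrow> 1/2 < w k"
    using order_tendstoD(1)[OF lim, of "1/2"] by (auto simp: eventually_sequentially)
  \<comment> \<open>From N on \<open>abs_ln_le\<close> applies and yields
    \<open>2 * \<bar>D\<bar>\<close>; the finitely many earlier terms are covered by their
    sum.\<close>
  define C where "C = 2 * \<bar>D\<bar> + (\<Sum>k<N. (real k + 1) * \<bar>ln (w k)\<bar>)"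
  have C: "(real k + 1) * \<bar>ln (w k)\<bar> \<le> C" if k: "1 \<le> k" for k
  proof (cases "k < N")
    case True
    have "(real k + 1) * \<bar>ln (w k)\<bar> \<le> (\<Sum>k<N. (real k + 1) * \<bar>ln (w k)\<bar>)"
      using True by (intro member_le_sum[of k "{..<N}" "\<lambda>k. (real k + 1) * \<bar>ln (w k)\<bar>"]) auto
    thus ?thesis by (simp add: C_def)
  next
    case False
    have "(real k + 1) * \<bar>ln (w k)\<bar> \<le> (real k + 1) * (2 * \<bar>w k - 1\<bar>)"
      using N[of k] False by (intro mult_left_mono abs_ln_le) auto
    also have "\<dots> \<le> 2 * \<bar>D\<bar>" using D[OF k] by simp
    also have "\<dots> \<le> C" unfolding C_def by (simp add: sum_nonneg)
    finally show ?thesis .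
  qed
  have C0: "0 \<le> C" using C[of 1] by (auto intro: order_trans[rotated])
  have lnb: "\<bar>ln (hardy_beta w (k + d)) - ln (hardy_beta w k)\<bar> \<le> real d * (C / real (Suc k))" for k d
  proof (induction d)
    case (Suc d)
    have "ln (hardy_beta w (k + Suc d)) = ln (hardy_beta w (k + d)) + ln (w (Suc (k + d)))"
      using pos[of "k + d"] wpos[of "Suc (k + d)"] by (simp add: hardy_beta_Suc ln_mult)
    moreover have "\<bar>ln (w (Suc (k + d)))\<bar> \<le> C / real (Suc k)"
    proof -
      have "\<bar>ln (w (Suc (k + d)))\<bar> \<le> C / (real (Suc (k + d)) + 1)"
        using C[of "Suc (k + d)"] by (simp add: pos_le_divide_eq mult.commute)
      also have "\<dots> \<le> C / real (Suc k)" using C0 by (intro divide_left_mono) auto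
      finally show ?thesis .
    qed
    moreover have "real (Suc d) * (C / real (Suc k)) = real d * (C / real (Suc k)) + C / real (Suc k)"
      by (simp only: of_nat_Suc distrib_right mult_1)
    ultimately show ?case using Suc by linarith
  qed simp
  fix L :: nat
  have main: "\<bar>ln (hardy_beta w n) - ln (hardy_beta w k)\<bar> \<le> real L * C"
    if "k \<le> n" "Suc n \<le> L * Suc k" for k n
  proof -
    have "n - k \<le> L * Suc k" using that by linarith
    hence "real (n - k) \<le> real L * real (Suc k)" by (simp only: of_nat_mult[symmetric] of_nat_le_iff)
    hence "real (n - k) * (C / real (Suc k)) \<le> real L * real (Suc k) * (C / real (Suc k))"
      using C0 by (intro mult_right_mono) auto
    also have "\<dots> = real L * C" by simp
    finally show ?thesis using lnb[of k "n - k"] that(1) by simp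
  qed
  show "\<exists>K>0. \<forall>k n. Suc k \<le> L * Suc n \<longrightarrow> Suc n \<le> L * Suc k \<longrightarrow> hardy_beta w k \<le> K * hardy_beta w n"
  proof (intro exI[of _ "exp (real L * C)"] conjI allI impI)
    fix k n assume kn: "Suc k \<le> L * Suc n" "Suc n \<le> L * Suc k"
    have "ln (hardy_beta w k) \<le> real L * C + ln (hardy_beta w n)"
      using main[of k n] main[of n k] kn by (cases "k \<le> n") auto
    hence "exp (ln (hardy_beta w k)) \<le> exp (real L * C + ln (hardy_beta w n))" by simp
    thus "hardy_beta w k \<le> exp (real L * C) * hardy_beta w n" using pos by (simp add: exp_add)
  qed simp
qed

subsection \<open>The similarity\<close>

lemma elems_weighted_hardy:
  "f \<in> elems (weighted_hardy w) \<longleftrightarrow>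
     f holomorphic_on ball 0 1 \<and> (\<forall>z. z \<notin> ball 0 1 \<longrightarrow> f z = 0) \<and> weighted_l2 (hardy_beta w) (taylor_coeff f)"
  by (simp add: weighted_hardy_def weighted_l2_def)

lemma vnorm_weighted_hardy: "vnorm (weighted_hardy w) f = weighted_norm (hardy_beta w) (taylor_coeff f)"
  by (simp add: weighted_hardy_def weighted_norm_def)

lemma vplus_weighted_hardy: "vplus (weighted_hardy w) f g = (\<lambda>z. f z + g z)"
  and vscale_weighted_hardy: "vscale (weighted_hardy w) b f = (\<lambda>z. b * f z)"
  by (simp_all add: weighted_hardy_def)

lemma elems_direct_sum: "elems (direct_sum I H) = (\<Pi>\<^sub>E i\<in>I. elems (H i))"
  and vplus_direct_sum: "vplus (direct_sum I H) F G = (\<lambda>i\<in>I. vplus (H i) (F i) (G i))"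
  and vscale_direct_sum: "vscale (direct_sum I H) b F = (\<lambda>i\<in>I. vscale (H i) b (F i))"
  and vnorm_direct_sum: "vnorm (direct_sum I H) F = L2_set (\<lambda>i. vnorm (H i) (F i)) I"
  by (simp_all add: direct_sum_def L2_set_def)

lemma weighted_hardy_add:
  assumes "f \<in> elems (weighted_hardy w)" "g \<in> elems (weighted_hardy w)"
  shows "(\<lambda>z. f z + g z) \<in> elems (weighted_hardy w)"
proof -
  have "taylor_coeff (\<lambda>z. f z + g z) = (\<lambda>k. taylor_coeff f k + taylor_coeff g k)"
    using assms by (intro ext taylor_coeff_add[of 1]) (auto simp: elems_weighted_hardy)
  thus ?thesis using assms
    by (auto simp: elems_weighted_hardy weighted_l2_add intro!: holomorphic_intros)
qed

lemma weighted_hardy_scale: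
  assumes "f \<in> elems (weighted_hardy w)"
  shows "(\<lambda>z. b * f z) \<in> elems (weighted_hardy w)"
proof -
  have "taylor_coeff (\<lambda>z. b * f z) = (\<lambda>k. b * taylor_coeff f k)"
    using assms by (intro ext taylor_coeff_cmult[of 1]) (auto simp: elems_weighted_hardy)
  moreover have "weighted_l2 \<beta> (\<lambda>k. b * x k)" if "weighted_l2 \<beta> x" for \<beta> x
    using summable_mult[OF that[unfolded weighted_l2_def], of "(cmod b)\<^sup>2"]
    by (simp add: weighted_l2_def norm_mult power_mult_distrib mult.assoc)
  ultimately show ?thesis using assms
    by (auto simp: elems_weighted_hardy intro!: holomorphic_intros)
qed

lemma weighted_hardy_eqI:
  assumes "f \<in> elems (weighted_hardy w)" "g \<in> elems (weighted_hardy w)" "taylor_coeff f = taylor_coeff g"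
  shows "f = g"
proof
  fix z
  show "f z = g z"
  proof (cases "z \<in> ball 0 1")
    case True
    thus ?thesis using assms sums_unique2 taylor_coeff_sums by (metis elems_weighted_hardy)
  next
    case False
    thus ?thesis using assms by (simp add: elems_weighted_hardy)
  qed
qed

definition power_function :: "(nat \<Rightarrow> complex) \<Rightarrow> complex \<Rightarrow> complex" where
  "power_function x z = (if z \<in> ball 0 1 then \<Sum>k. x k * z ^ k else 0)"

text \<open>Together with \<open>weighted_hardy_eqI\<close> this identifies the function space with
  the weighted sequence space; convergence on the full disk is
  \<open>summable_coeff\<close>.\<close>

lemma power_function:
  assumes "regular_weight (hardy_beta w)" "weighted_l2 (hardy_beta w) x"
  shows "taylor_coeff (power_function x) = x" "power_function x \<in> elems (weighted_hardy w)"
proof -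
  interpret regular_weight "hardy_beta w" by fact
  have sums: "(\<lambda>k. x k * z ^ k) sums power_function x z" if "z \<in> ball 0 1" for z
  proof -
    have "summable (\<lambda>k. norm (x k * z ^ k))"
      using summable_coeff[OF assms(2), of "cmod z"] that by (simp add: norm_mult norm_power)
    thus ?thesis using that by (simp add: power_function_def summable_norm_cancel summable_sums)
  qed
  show 1: "taylor_coeff (power_function x) = x" by (rule taylor_coeff_unique[OF _ sums]) auto
  have "power_function x holomorphic_on ball 0 1"
    by (rule power_series_holomorphic[where a = x]) (use sums in simp)
  thus "power_function x \<in> elems (weighted_hardy w)"
    using 1 assms(2) by (simp add: elems_weighted_hardy power_function_def)
qed

lemma bounded_operator_mult_z:
  assumes "regular_weight (hardy_beta w)"
  shows "bounded_operator (weighted_hardy w) (weighted_hardy w) (mult_operator (\<lambda>z. z))"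
proof -
  interpret regular_weight "hardy_beta w" by fact
  \<comment> \<open>Consecutive weights are comparable, as k + 2 is at most 2 (k + 1).\<close>
  obtain K where K: "K > 0" and K': "\<And>k n. Suc k \<le> 2 * Suc n \<Longrightarrow> Suc n \<le> 2 * Suc k \<Longrightarrow> hardy_beta w k \<le> K * hardy_beta w n"
    using comparable[of 2] by blast
  have main: "mult_operator (\<lambda>z. z) f \<in> elems (weighted_hardy w)
      \<and> vnorm (weighted_hardy w) (mult_operator (\<lambda>z. z) f) \<le> K * vnorm (weighted_hardy w) f"
    if f: "f \<in> elems (weighted_hardy w)" for f
  proof -
    define x where "x = taylor_coeff f"
    have x: "weighted_l2 (hardy_beta w) x" using f by (simp add: x_def elems_weighted_hardy)
    define y where "y k = (if k = 0 then 0 else x (k - 1))" for k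
    have t: "taylor_coeff (mult_operator (\<lambda>z. z) f) = y"
      unfolding mult_operator_def y_def x_def
      by (rule taylor_coeff_mult_z[of 1]) (use f in \<open>auto simp: elems_weighted_hardy\<close>)
    have "L2_set (\<lambda>k. cmod (y k) * hardy_beta w k) {..<N} \<le> K * weighted_norm (hardy_beta w) x" for N
    proof -
      \<comment> \<open>With one extra term, the first N + 1 entries of y are a 0 followed by the
        first N entries of x.\<close>
      have "L2_set (\<lambda>k. cmod (y k) * hardy_beta w k) {..<N} \<le> L2_set (\<lambda>k. cmod (y k) * hardy_beta w k) {..<Suc N}"
        unfolding L2_set_def by (intro real_sqrt_le_mono sum_mono2) auto
      also have "\<dots> = L2_set (\<lambda>k. cmod (x k) * hardy_beta w (Suc k)) {..<N}"
        unfolding L2_set_def by (subst sum.lessThan_Suc_shift) (simp add: y_def)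
      also have "\<dots> \<le> L2_set (\<lambda>k. K * (cmod (x k) * hardy_beta w k)) {..<N}"
      proof (intro L2_set_mono)
        fix k
        have "cmod (x k) * hardy_beta w (Suc k) \<le> cmod (x k) * (K * hardy_beta w k)"
          by (intro mult_left_mono K') auto
        thus "cmod (x k) * hardy_beta w (Suc k) \<le> K * (cmod (x k) * hardy_beta w k)" by (simp add: mult_ac)
      qed (use pos in \<open>simp add: less_imp_le\<close>)
      also have "\<dots> = K * L2_set (\<lambda>k. cmod (x k) * hardy_beta w k) {..<N}"
        using K by (simp add: L2_set_right_distrib)
      also have "\<dots> \<le> K * weighted_norm (hardy_beta w) x"
        using K x by (intro mult_left_mono L2_set_le_weighted_norm) auto
      finally show ?thesis .
    qed
    note y = weighted_normI[OF this]
    have "mult_operator (\<lambda>z. z) f holomorphic_on ball 0 1"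
      unfolding mult_operator_def using f by (auto simp: elems_weighted_hardy intro!: holomorphic_intros)
    thus ?thesis
      using y f unfolding elems_weighted_hardy vnorm_weighted_hardy t x_def[symmetric] by (simp add: mult_operator_def)
  qed
  show ?thesis
    unfolding bounded_operator_def vplus_weighted_hardy vscale_weighted_hardy
    using main by (auto simp: mult_operator_def algebra_simps)
qed

section \<open>Composition and direct sums of bounded operators\<close>

lemma bounded_operator_compose:
  assumes T: "bounded_operator H K T" and T': "bounded_operator K H' T'"
    and nonneg: "\<And>x. x \<in> elems K \<Longrightarrow> 0 \<le> vnorm K x"
  shows "bounded_operator H H' (T' \<circ> T)"
proof -
  obtain C C' where C: "\<And>x. x \<in> elems H \<Longrightarrow> vnorm K (T x) \<le> C * vnorm H x"
    and C': "\<And>x. x \<in> elems K \<Longrightarrow> vnorm H' (T' x) \<le> C' * vnorm K x"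
    using T T' unfolding bounded_operator_def by metis
  have "vnorm H' (T' (T x)) \<le> \<bar>C'\<bar> * C * vnorm H x" if x: "x \<in> elems H" for x
  proof -
    have Tx: "T x \<in> elems K" using T x by (auto simp: bounded_operator_def)
    \<comment> \<open>\<open>bounded_operator\<close> allows a negative constant; its absolute value
      is a bound too because norms on K are nonnegative.\<close>
    have "vnorm H' (T' (T x)) \<le> \<bar>C'\<bar> * vnorm K (T x)"
      using C'[OF Tx] mult_right_mono[OF abs_ge_self nonneg[OF Tx], of C'] by linarith
    also have "\<dots> \<le> \<bar>C'\<bar> * (C * vnorm H x)" by (intro mult_left_mono C x) auto
    finally show ?thesis by simp
  qed
  thus ?thesis using T T' unfolding bounded_operator_def by (auto simp: Pi_iff)
qed

lemma bounded_operator_direct_sum: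
  assumes A: "\<And>i. i \<in> I \<Longrightarrow> bounded_operator (H i) (H i) (A i)"
    and nonneg: "\<And>i x. i \<in> I \<Longrightarrow> x \<in> elems (H i) \<Longrightarrow> 0 \<le> vnorm (H i) x" and "finite I"
  shows "bounded_operator (direct_sum I H) (direct_sum I H) (direct_sum_operator I A)"
proof -
  obtain C where C: "\<And>i x. i \<in> I \<Longrightarrow> x \<in> elems (H i) \<Longrightarrow> vnorm (H i) (A i x) \<le> C i * vnorm (H i) x"
    using A unfolding bounded_operator_def by metis
  define D where "D = (\<Sum>i\<in>I. \<bar>C i\<bar>)"
  have D: "C i \<le> D" "0 \<le> D" if "i \<in> I" for i
    using member_le_sum[of i I "\<lambda>i. \<bar>C i\<bar>"] that \<open>finite I\<close> by (auto simp: D_def sum_nonneg)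
  have D0: "0 \<le> D" by (simp add: D_def sum_nonneg)
  have bound: "vnorm (direct_sum I H) (direct_sum_operator I A F) \<le> D * vnorm (direct_sum I H) F"
    if F: "F \<in> elems (direct_sum I H)" for F
  proof -
    have Fi: "F i \<in> elems (H i)" if "i \<in> I" for i using F that by (auto simp: elems_direct_sum)
    have Ai: "A i (F i) \<in> elems (H i)" if "i \<in> I" for i
      using A[OF that] Fi[OF that] by (auto simp: bounded_operator_def)
    have "L2_set (\<lambda>i. vnorm (H i) (direct_sum_operator I A F i)) I \<le> L2_set (\<lambda>i. D * vnorm (H i) (F i)) I"
    proof (intro L2_set_mono)
      fix i assume i: "i \<in> I"
      show "vnorm (H i) (direct_sum_operator I A F i) \<le> D * vnorm (H i) (F i)"
        using order_trans[OF C[OF i Fi[OF i]] mult_right_mono[OF D(1)[OF i] nonneg[OF i Fi[OF i]]]] i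
        by (simp add: direct_sum_operator_def)
      show "0 \<le> vnorm (H i) (direct_sum_operator I A F i)"
        using nonneg[OF i Ai[OF i]] i by (simp add: direct_sum_operator_def)
    qed
    thus ?thesis using D0 by (simp add: vnorm_direct_sum L2_set_right_distrib)
  qed
  have "direct_sum_operator I A \<in> elems (direct_sum I H) \<rightarrow> elems (direct_sum I H)"
    using A by (auto simp: elems_direct_sum direct_sum_operator_def bounded_operator_def Pi_iff PiE_iff)
  moreover have "direct_sum_operator I A (vplus (direct_sum I H) F G)
      = vplus (direct_sum I H) (direct_sum_operator I A F) (direct_sum_operator I A G)"
    if "F \<in> elems (direct_sum I H)" "G \<in> elems (direct_sum I H)" for F G
    using A that
    by (auto simp: elems_direct_sum vplus_direct_sum direct_sum_operator_def bounded_operator_def PiE_iff intro!: ext)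
  moreover have "direct_sum_operator I A (vscale (direct_sum I H) b F)
      = vscale (direct_sum I H) b (direct_sum_operator I A F)" if "F \<in> elems (direct_sum I H)" for F b
    using A that
    by (auto simp: elems_direct_sum vscale_direct_sum direct_sum_operator_def bounded_operator_def PiE_iff intro!: ext)
  ultimately show ?thesis using bound unfolding bounded_operator_def by blast
qed

section \<open>Synthesis and analysis as mutually inverse operators\<close>

locale hardy_blaschke = blaschke m a c + regular_weight "hardy_beta w" for m a c w
begin

abbreviation "H \<equiv> weighted_hardy w"
abbreviation "HH \<equiv> direct_sum {1..m} (\<lambda>_. weighted_hardy w)"
abbreviation "\<beta> \<equiv> hardy_beta w"

definition synthesis :: "(nat \<Rightarrow> complex \<Rightarrow> complex) \<Rightarrow> complex \<Rightarrow> complex" where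
  "synthesis F z = (if z \<in> ball 0 1 then \<Sum>j\<in>{1..m}. takenaka a j z * F j (B z) else 0)"

text \<open>The conjugate transpose is taken for the unweighted inner product, so in general this is
  not the Hilbert space adjoint of \<open>synthesis\<close> on the weighted spaces.\<close>

definition analysis :: "(complex \<Rightarrow> complex) \<Rightarrow> nat \<Rightarrow> complex \<Rightarrow> complex" where
  "analysis f = (\<lambda>j\<in>{1..m}. power_function (\<lambda>n. \<Sum>k. cnj (entry j k n) * taylor_coeff f k))"

lemma component: "F \<in> elems HH \<Longrightarrow> j \<in> {1..m} \<Longrightarrow> F j \<in> elems H"
  by (auto simp: elems_direct_sum PiE_iff)

lemma vnorm_component_le: "j \<in> {1..m} \<Longrightarrow> vnorm H (F j) \<le> vnorm HH F"
  unfolding vnorm_direct_sum by (intro member_le_L2_set) auto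

text \<open>On the disk of radius 1/2 the functions \<open>takenaka a j z * B z ^ n\<close> are
  dominated by \<open>M * s ^ n\<close> with s < 1, so substituting B into the series of F converges
  normally there.\<close>

lemma taylor_coeff_takenaka_comp_B:
  assumes j: "j \<in> {1..m}" and F: "F holomorphic_on ball 0 1" "weighted_l2 \<beta> (taylor_coeff F)"
  shows "(\<lambda>n. entry j k n * taylor_coeff F n) sums taylor_coeff (\<lambda>z. takenaka a j z * F (B z)) k"
proof -
  obtain M s where *: "0 < M" "0 < s" "s < 1"
    and bs: "\<And>j n z. j \<in> {1..m} \<Longrightarrow> z \<in> cball 0 (1/2) \<Longrightarrow> cmod (takenaka a j z * B z ^ n) \<le> M * s ^ n"
    using entry_bounds by metis
  have ball: "ball (0::complex) (1/2) \<subseteq> ball 0 radius" using radius_gt_1 by auto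
  note hol = holomorphic_on_subset[OF holomorphic_basis[OF j] ball]
  have "(\<lambda>n. taylor_coeff (\<lambda>z. taylor_coeff F n * (takenaka a j z * B z ^ n)) k)
      sums taylor_coeff (\<lambda>z. \<Sum>n. taylor_coeff F n * (takenaka a j z * B z ^ n)) k"
  proof (rule taylor_coeff_suminf)
    show "summable (\<lambda>n. M * (cmod (taylor_coeff F n) * s ^ n))"
      using * F by (intro summable_mult summable_coeff) auto
    fix n and z :: complex assume "z \<in> ball 0 (1/2)"
    hence "cmod (taylor_coeff F n) * cmod (takenaka a j z * B z ^ n) \<le> cmod (taylor_coeff F n) * (M * s ^ n)"
      using j by (intro mult_left_mono bs) auto
    thus "cmod (taylor_coeff F n * (takenaka a j z * B z ^ n)) \<le> M * (cmod (taylor_coeff F n) * s ^ n)"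
      by (simp add: norm_mult mult_ac)
  qed (auto intro!: holomorphic_on_mult[OF holomorphic_on_const] hol)
  also have "taylor_coeff (\<lambda>z. \<Sum>n. taylor_coeff F n * (takenaka a j z * B z ^ n))
      = taylor_coeff (\<lambda>z. takenaka a j z * F (B z))"
  proof (rule taylor_coeff_cong)
    fix z :: complex assume "z \<in> ball 0 (1/2)"
    hence "B z \<in> ball 0 1" by (intro B_in_disc) auto
    hence "(\<lambda>n. takenaka a j z * (taylor_coeff F n * B z ^ n)) sums (takenaka a j z * F (B z))"
      by (intro sums_mult taylor_coeff_sums[OF F(1)])
    thus "(\<Sum>n. taylor_coeff F n * (takenaka a j z * B z ^ n)) = takenaka a j z * F (B z)"
      by (intro sums_unique[symmetric]) (simp add: mult_ac)
  qed simp
  also have "(\<lambda>n. taylor_coeff (\<lambda>z. taylor_coeff F n * (takenaka a j z * B z ^ n)) k)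
      = (\<lambda>n. entry j k n * taylor_coeff F n)"
    by (intro ext, subst taylor_coeff_cmult[OF _ hol]) (auto simp: entry_def)
  finally show ?thesis .
qed

lemma synthesis_holomorphic:
  assumes "\<And>j. j \<in> {1..m} \<Longrightarrow> F j holomorphic_on ball 0 1"
  shows "synthesis F holomorphic_on ball 0 1"
proof -
  have "(\<lambda>z. \<Sum>j\<in>{1..m}. takenaka a j z * F j (B z)) holomorphic_on ball 0 1"
    by (intro holomorphic_intros holomorphic_takenaka_comp_B assms)
  thus ?thesis by (rule holomorphic_transform) (simp add: synthesis_def)
qed

lemma taylor_coeff_synthesis:
  assumes F: "F \<in> elems HH"
  shows "taylor_coeff (synthesis F) = (\<lambda>k. \<Sum>j\<in>{1..m}. \<Sum>n. entry j k n * taylor_coeff (F j) n)"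
proof
  fix k
  have Fj: "F j holomorphic_on ball 0 1" "weighted_l2 \<beta> (taylor_coeff (F j))" if "j \<in> {1..m}" for j
    using component[OF F that] by (auto simp: elems_weighted_hardy)
  have "taylor_coeff (synthesis F) k = taylor_coeff (\<lambda>z. \<Sum>j\<in>{1..m}. takenaka a j z * F j (B z)) k"
    by (subst taylor_coeff_cong[of 1 "synthesis F"]) (auto simp: synthesis_def)
  also have "\<dots> = (\<Sum>j\<in>{1..m}. taylor_coeff (\<lambda>z. takenaka a j z * F j (B z)) k)"
    by (rule taylor_coeff_sum[of 1]) (auto intro!: holomorphic_takenaka_comp_B Fj)
  also have "\<dots> = (\<Sum>j\<in>{1..m}. \<Sum>n. entry j k n * taylor_coeff (F j) n)"
    by (intro sum.cong refl sums_unique taylor_coeff_takenaka_comp_B Fj)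
  finally show "taylor_coeff (synthesis F) k = (\<Sum>j\<in>{1..m}. \<Sum>n. entry j k n * taylor_coeff (F j) n)" .
qed

text \<open>The region of decay is symmetric in k and n, so the weighted estimate serves the
  conjugate transpose as well.\<close>

lemma weighted_entry:
  assumes "j \<in> {1..m}"
  shows "\<exists>C. form_bounded (\<lambda>k n. of_real (\<beta> k) * entry j k n / of_real (\<beta> n)) C"
    and "\<exists>C. form_bounded (\<lambda>n k. of_real (\<beta> n) * cnj (entry j k n) / of_real (\<beta> k)) C"
proof -
  obtain M \<rho> L where *: "0 \<le> M" "0 < \<rho>" "\<rho> < 1"
    and dec: "\<And>k n. L * Suc n \<le> Suc k \<or> L * Suc k \<le> Suc n \<Longrightarrow> cmod (entry j k n) \<le> M * \<rho> ^ (k + n)"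
    using entry_decay assms by metis
  show "\<exists>C. form_bounded (\<lambda>k n. of_real (\<beta> k) * entry j k n / of_real (\<beta> n)) C"
    by (rule form_bounded_weighted[OF form_bounded_entry[OF assms] *(2,3,1) dec])
  have "cmod (cnj (entry j k n)) \<le> M * \<rho> ^ (n + k)" if "L * Suc k \<le> Suc n \<or> L * Suc n \<le> Suc k" for k n
    using dec[of n k] that by (auto simp: add.commute)
  thus "\<exists>C. form_bounded (\<lambda>n k. of_real (\<beta> n) * cnj (entry j k n) / of_real (\<beta> k)) C"
    by (rule form_bounded_weighted[OF form_bounded_adjoint[OF form_bounded_entry[OF assms]] *(2,3,1)])
qed

lemma bounded_operator_synthesis: "bounded_operator HH H synthesis"
proof -
  have "\<forall>j\<in>{1..m}. \<exists>C. form_bounded (\<lambda>k n. of_real (\<beta> k) * entry j k n / of_real (\<beta> n)) C"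
    using weighted_entry(1) by blast
  from bchoice[OF this] obtain C where C: "\<forall>j\<in>{1..m}. form_bounded (\<lambda>k n. of_real (\<beta> k) * entry j k n / of_real (\<beta> n)) (C j)" ..
  note C = C[rule_format]
  have main: "synthesis F \<in> elems H \<and> vnorm H (synthesis F) \<le> (\<Sum>j\<in>{1..m}. C j) * vnorm HH F" if F: "F \<in> elems HH" for F
  proof -
    have Fj: "F j holomorphic_on ball 0 1" "weighted_l2 \<beta> (taylor_coeff (F j))" if "j \<in> {1..m}" for j
      using component[OF F that] by (auto simp: elems_weighted_hardy)
    define y where "y j k = (\<Sum>n. entry j k n * taylor_coeff (F j) n)" for j k
    have y: "weighted_l2 \<beta> (y j)" "weighted_norm \<beta> (y j) \<le> C j * weighted_norm \<beta> (taylor_coeff (F j))"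
      if j: "j \<in> {1..m}" for j
    proof -
      have "summable (\<lambda>n. entry j k n * taylor_coeff (F j) n)" for k
        by (rule sums_summable) (rule taylor_coeff_takenaka_comp_B[OF j Fj[OF j]])
      note * = matrix_operator_bounded[where u = "entry j" and x = "taylor_coeff (F j)", OF C[OF j] Fj(2)[OF j] this]
      show "weighted_l2 \<beta> (y j)" "weighted_norm \<beta> (y j) \<le> C j * weighted_norm \<beta> (taylor_coeff (F j))"
        unfolding y_def using * by auto
    qed
    have t: "taylor_coeff (synthesis F) = (\<lambda>k. \<Sum>j\<in>{1..m}. y j k)"
      unfolding y_def by (rule taylor_coeff_synthesis[OF F])
    have C0: "0 \<le> C j" if "j \<in> {1..m}" for j using C[OF that] by (simp add: form_bounded_def)
    have "(\<Sum>j\<in>{1..m}. weighted_norm \<beta> (y j)) \<le> (\<Sum>j\<in>{1..m}. C j * vnorm HH F)"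
    proof (intro sum_mono)
      fix j assume j: "j \<in> {1..m}"
      have "C j * vnorm H (F j) \<le> C j * vnorm HH F"
        using C0[OF j] by (intro mult_left_mono vnorm_component_le j)
      thus "weighted_norm \<beta> (y j) \<le> C j * vnorm HH F" using y(2)[OF j] by (simp add: vnorm_weighted_hardy)
    qed
    thus ?thesis
      using weighted_norm_triangle_sum[of "{1..m}" \<beta> y] y(1) synthesis_holomorphic[OF Fj(1)]
      by (simp add: elems_weighted_hardy vnorm_weighted_hardy t synthesis_def sum_distrib_right)
  qed
  have "synthesis (vplus HH F G) = vplus H (synthesis F) (synthesis G)" for F G
    by (rule ext) (simp add: vplus_direct_sum vplus_weighted_hardy synthesis_def sum.distrib distrib_left)
  moreover have "synthesis (vscale HH b F) = vscale H b (synthesis F)" for F b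
    by (rule ext) (simp add: vscale_direct_sum vscale_weighted_hardy synthesis_def sum_distrib_left mult.left_commute)
  ultimately show ?thesis using main unfolding bounded_operator_def by blast
qed

lemma synthesis_inj:
  assumes F: "F \<in> elems HH" and G: "G \<in> elems HH" and eq: "synthesis F = synthesis G"
  shows "F = G"
proof -
  have "F j = G j" if j: "j \<in> {1..m}" for j
  proof (rule weighted_hardy_eqI[OF component[OF F j] component[OF G j]])
    have hol: "F i holomorphic_on ball 0 1" "G i holomorphic_on ball 0 1" if "i \<in> {1..m}" for i
      using component[OF F that] component[OF G that] by (auto simp: elems_weighted_hardy)
    have "(\<Sum>i\<in>{1..m}. takenaka a i z * (F i (B z) + (- 1) * G i (B z))) = 0" if "z \<in> ball 0 1" for z
      using fun_cong[OF eq, of z] that by (simp add: synthesis_def algebra_simps sum_subtractf)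
    hence "taylor_coeff (\<lambda>z. F j z + (- 1) * G j z) k = 0" for k
      using takenaka_independent[of "\<lambda>i z. F i z + (- 1) * G i z", OF _ _ j] hol
      by (auto intro!: holomorphic_intros)
    moreover have "taylor_coeff (\<lambda>z. F j z + (- 1) * G j z) k = taylor_coeff (F j) k - taylor_coeff (G j) k" for k
      using taylor_coeff_add[of 1 "F j" "\<lambda>z. (- 1) * G j z" k] taylor_coeff_cmult[of 1 "G j" "- 1" k] hol[OF j]
      by (simp add: holomorphic_on_minus)
    ultimately show "taylor_coeff (F j) = taylor_coeff (G j)" by auto
  qed
  thus ?thesis
    by (intro PiE_ext[OF F[unfolded elems_direct_sum] G[unfolded elems_direct_sum]])
qed

text \<open>For fixed n the function behind column n is analytic beyond the unit circle, so its
  coefficients decay like \<open>1 / R ^ k\<close>, while x grows subexponentially.\<close>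

lemma summable_cnj_entry:
  assumes "j \<in> {1..m}" "weighted_l2 \<beta> x"
  shows "summable (\<lambda>k. cnj (entry j k n) * x k)"
proof -
  obtain M S R where *: "0 < M" "1 < S" "1 < R"
    and eS: "\<And>j k n. j \<in> {1..m} \<Longrightarrow> cmod (entry j k n) \<le> M * S ^ n / R ^ k"
    using entry_bounds by metis
  show ?thesis
  proof (rule summable_comparison_test')
    show "summable (\<lambda>k. M * S ^ n * (cmod (x k) * (1 / R) ^ k))"
      using * by (intro summable_mult summable_coeff assms) auto
    fix k
    have "cmod (entry j k n) * cmod (x k) \<le> M * S ^ n / R ^ k * cmod (x k)"
      by (intro mult_right_mono eS assms) auto
    thus "norm (cnj (entry j k n) * x k) \<le> M * S ^ n * (cmod (x k) * (1 / R) ^ k)"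
      by (simp add: norm_mult power_divide mult_ac)
  qed
qed

text \<open>The formula for the coefficients is proved along with the bound because
  \<open>power_function\<close> returns its sequence only once that sequence is known to be weighted
  square summable.\<close>

lemma analysis_bounded:
  "\<exists>D. \<forall>f\<in>elems H. analysis f \<in> elems HH \<and> vnorm HH (analysis f) \<le> D * vnorm H f \<and>
     (\<forall>j\<in>{1..m}. taylor_coeff (analysis f j) = (\<lambda>n. \<Sum>k. cnj (entry j k n) * taylor_coeff f k))"
proof -
  have "\<forall>j\<in>{1..m}. \<exists>C. form_bounded (\<lambda>n k. of_real (\<beta> n) * cnj (entry j k n) / of_real (\<beta> k)) C"
    using weighted_entry(2) by blast
  from bchoice[OF this] obtain C where C: "\<forall>j\<in>{1..m}. form_bounded (\<lambda>n k. of_real (\<beta> n) * cnj (entry j k n) / of_real (\<beta> k)) (C j)" ..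
  note C = C[rule_format]
  show ?thesis
  proof (intro exI[of _ "\<Sum>j\<in>{1..m}. C j"] ballI)
    fix f assume f: "f \<in> elems H"
    define x where "x = taylor_coeff f"
    have x: "weighted_l2 \<beta> x" using f by (simp add: x_def elems_weighted_hardy)
    define g where "g j n = (\<Sum>k. cnj (entry j k n) * x k)" for j n
    have g: "weighted_l2 \<beta> (g j)" "weighted_norm \<beta> (g j) \<le> C j * weighted_norm \<beta> x" if j: "j \<in> {1..m}" for j
    proof -
      note * = matrix_operator_bounded[where u = "\<lambda>n k. cnj (entry j k n)" and x = x, OF C[OF j] x summable_cnj_entry[OF j x]]
      show "weighted_l2 \<beta> (g j)" "weighted_norm \<beta> (g j) \<le> C j * weighted_norm \<beta> x"
        unfolding g_def using * by auto
    qed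
    have A: "analysis f j = power_function (g j)" if "j \<in> {1..m}" for j
      using that by (simp add: analysis_def g_def[abs_def] x_def)
    have p: "taylor_coeff (analysis f j) = g j" "analysis f j \<in> elems H" if j: "j \<in> {1..m}" for j
      unfolding A[OF j] by (rule power_function[OF regular_weight_axioms g(1)[OF j]])+
    have 1: "analysis f \<in> elems HH"
      using p(2) by (auto simp: elems_direct_sum PiE_iff analysis_def)
    have "vnorm HH (analysis f) \<le> (\<Sum>j\<in>{1..m}. vnorm H (analysis f j))"
      unfolding vnorm_direct_sum
      using p g(1) by (intro L2_set_le_sum) (auto simp: vnorm_weighted_hardy weighted_norm_nonneg)
    also have "\<dots> \<le> (\<Sum>j\<in>{1..m}. C j * vnorm H f)"
      using g(2) p by (intro sum_mono) (auto simp: vnorm_weighted_hardy x_def)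
    finally have 2: "vnorm HH (analysis f) \<le> (\<Sum>j\<in>{1..m}. C j) * vnorm H f"
      by (simp add: sum_distrib_right)
    show "analysis f \<in> elems HH \<and> vnorm HH (analysis f) \<le> (\<Sum>j\<in>{1..m}. C j) * vnorm H f \<and>
      (\<forall>j\<in>{1..m}. taylor_coeff (analysis f j) = (\<lambda>n. \<Sum>k. cnj (entry j k n) * taylor_coeff f k))"
      using 1 2 p(1) by (auto simp: g_def[abs_def] x_def)
  qed
qed

text \<open>Coefficientwise this is the orthonormality of the rows in
  \<open>entry_coisometry\<close>; the work lies in exchanging the sum over n with the sum over the
  coefficients of f.\<close>

lemma synthesis_analysis:
  assumes f: "f \<in> elems H"
  shows "synthesis (analysis f) = f"
proof -
  obtain M s S R where *: "0 < M" "0 < s" "s < 1" "1 < S" "1 < R" "s * S < 1"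
    and es: "\<And>j k n. j \<in> {1..m} \<Longrightarrow> cmod (entry j k n) \<le> M * s ^ n * 2 ^ k"
    and eS: "\<And>j k n. j \<in> {1..m} \<Longrightarrow> cmod (entry j k n) \<le> M * S ^ n / R ^ k"
    using entry_bounds by metis
  have A: "analysis f \<in> elems HH"
    and At: "\<And>j. j \<in> {1..m} \<Longrightarrow> taylor_coeff (analysis f j) = (\<lambda>n. \<Sum>k. cnj (entry j k n) * taylor_coeff f k)"
    using analysis_bounded f by blast+
  have S: "synthesis (analysis f) \<in> elems H"
    using bounded_operator_synthesis A by (auto simp: bounded_operator_def)
  define x where "x = taylor_coeff f"
  have x: "weighted_l2 \<beta> x" using f by (simp add: x_def elems_weighted_hardy)
  have "taylor_coeff (synthesis (analysis f)) k = x k" for k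
  proof -
    \<comment> \<open>Cutting n off at N makes the exchange a finite matter; the limit in N is then
      taken under the sum over l by Tannery's theorem.\<close>
    define p where "p l N = (\<Sum>n<N. \<Sum>j\<in>{1..m}. entry j k n * cnj (entry j l n)) * x l" for l N
    have lim1: "(\<lambda>N. \<Sum>l. p l N) \<longlonglongrightarrow> (\<Sum>l. (if k = l then 1 else 0) * x l)"
    proof (rule tannerys_theorem[THEN conjunct2, THEN conjunct2])
      show "(\<lambda>N. p l N) \<longlonglongrightarrow> (if k = l then 1 else 0) * x l" for l
        unfolding p_def by (intro tendsto_mult_right entry_coisometry[unfolded sums_def])
      \<comment> \<open>Row k is estimated by \<open>s ^ n\<close> and row l by
        \<open>S ^ n / R ^ l\<close>: the sum over n is bounded uniformly in N by
        \<open>s * S < 1\<close>, and R > 1 leaves decay in l.\<close>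
      define E where "E = (\<Sum>n. (s * S) ^ n)"
      show "summable (\<lambda>l. real m * (M * 2 ^ k * M) * E * (cmod (x l) * (1 / R) ^ l))"
        using * by (intro summable_mult summable_coeff x) auto
      have "cmod (p l N) \<le> real m * (M * 2 ^ k * M) * E * (cmod (x l) * (1 / R) ^ l)" for l N
      proof -
        have "cmod (\<Sum>n<N. \<Sum>j\<in>{1..m}. entry j k n * cnj (entry j l n))
            \<le> (\<Sum>n<N. \<Sum>j\<in>{1..m}. (M * s ^ n * 2 ^ k) * (M * S ^ n / R ^ l))"
        proof (intro sum_norm_le)
          fix n j assume j: "j \<in> {1..m}"
          show "cmod (entry j k n * cnj (entry j l n)) \<le> (M * s ^ n * 2 ^ k) * (M * S ^ n / R ^ l)"
            unfolding norm_mult complex_mod_cnj using * by (intro mult_mono es eS j) auto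
        qed
        also have "\<dots> = (real m * (M * 2 ^ k * M) / R ^ l) * (\<Sum>n<N. (s * S) ^ n)"
          by (simp add: sum_distrib_left sum_divide_distrib power_mult_distrib mult_ac)
        also have "\<dots> \<le> (real m * (M * 2 ^ k * M) / R ^ l) * E"
          unfolding E_def using *
          by (intro mult_left_mono sum_le_suminf summable_geometric) auto
        finally have "cmod (\<Sum>n<N. \<Sum>j\<in>{1..m}. entry j k n * cnj (entry j l n)) * cmod (x l)
             \<le> (real m * (M * 2 ^ k * M) / R ^ l) * E * cmod (x l)" by (rule mult_right_mono) simp
        thus ?thesis by (simp add: p_def norm_mult power_divide mult_ac)
      qed
      thus "eventually (\<lambda>(l,N). norm (p l N) \<le> real m * (M * 2 ^ k * M) * E * (cmod (x l) * (1 / R) ^ l))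
              (at_top \<times>\<^sub>F sequentially)" by (intro always_eventually) auto
    qed simp
    have "(\<Sum>l. p l N) = (\<Sum>n<N. \<Sum>j\<in>{1..m}. entry j k n * taylor_coeff (analysis f j) n)" for N
    proof -
      have "(\<lambda>l. \<Sum>n<N. \<Sum>j\<in>{1..m}. entry j k n * (cnj (entry j l n) * x l))
          sums (\<Sum>n<N. \<Sum>j\<in>{1..m}. entry j k n * (\<Sum>l. cnj (entry j l n) * x l))"
        by (intro sums_sum sums_mult summable_sums summable_cnj_entry x)
      thus ?thesis
        by (intro sums_unique[symmetric]) (simp add: p_def At x_def sum_distrib_left sum_distrib_right mult_ac)
    qed
    moreover have "(\<Sum>l. (if k = l then 1 else 0) * x l) = x k"
    proof -
      have "(\<lambda>l. (if k = l then 1 else 0) * x l) = (\<lambda>l. if l = k then x l else 0)" by auto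
      thus ?thesis using sums_unique[OF sums_single[of k x]] by simp
    qed
    ultimately have lim1': "(\<lambda>N. \<Sum>n<N. \<Sum>j\<in>{1..m}. entry j k n * taylor_coeff (analysis f j) n) \<longlonglongrightarrow> x k"
      using lim1 by simp
    have "(\<lambda>n. \<Sum>j\<in>{1..m}. entry j k n * taylor_coeff (analysis f j) n)
        sums (\<Sum>j\<in>{1..m}. taylor_coeff (\<lambda>z. takenaka a j z * analysis f j (B z)) k)"
      using component[OF A]
      by (intro sums_sum taylor_coeff_takenaka_comp_B) (auto simp: elems_weighted_hardy)
    hence "(\<Sum>j\<in>{1..m}. taylor_coeff (\<lambda>z. takenaka a j z * analysis f j (B z)) k) = x k"
      using lim1' LIMSEQ_unique unfolding sums_def by blast
    moreover have "taylor_coeff (synthesis (analysis f)) k = (\<Sum>j\<in>{1..m}. taylor_coeff (\<lambda>z. takenaka a j z * analysis f j (B z)) k)"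
      unfolding taylor_coeff_synthesis[OF A] using component[OF A]
      by (intro sum.cong refl sums_unique[symmetric] taylor_coeff_takenaka_comp_B) (auto simp: elems_weighted_hardy)
    ultimately show ?thesis by simp
  qed
  thus ?thesis by (intro weighted_hardy_eqI[OF S f]) (auto simp: x_def)
qed

text \<open>Linearity takes no work with series: both sides have the same image under the injective
  linear map \<open>synthesis\<close>, by \<open>synthesis_analysis\<close>.\<close>

lemma bounded_operator_analysis: "bounded_operator H HH analysis"
proof -
  have An: "analysis f \<in> elems HH" if "f \<in> elems H" for f using analysis_bounded that by blast
  have lin: "synthesis (vplus HH F G) = vplus H (synthesis F) (synthesis G)"
       "synthesis (vscale HH b F) = vscale H b (synthesis F)"
    if "F \<in> elems HH" "G \<in> elems HH" for F G b
    using bounded_operator_synthesis that unfolding bounded_operator_def by blast+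
  have cl: "vplus HH F G \<in> elems HH" "vscale HH b F \<in> elems HH" if "F \<in> elems HH" "G \<in> elems HH" for F G b
    using that unfolding elems_direct_sum vplus_direct_sum vscale_direct_sum vplus_weighted_hardy vscale_weighted_hardy
    by (auto simp: PiE_iff intro!: weighted_hardy_add weighted_hardy_scale)
  have clH: "vplus H f g \<in> elems H" "vscale H b f \<in> elems H" if "f \<in> elems H" "g \<in> elems H" for f g b
    using that unfolding vplus_weighted_hardy vscale_weighted_hardy
    by (auto intro: weighted_hardy_add weighted_hardy_scale)
  have "analysis (vplus H f g) = vplus HH (analysis f) (analysis g)" if "f \<in> elems H" "g \<in> elems H" for f g
    by (rule synthesis_inj[OF An[OF clH(1)[OF that]] cl(1)[OF An[OF that(1)] An[OF that(2)]]])
       (simp only: lin(1)[OF An[OF that(1)] An[OF that(2)]] synthesis_analysis that clH(1)[OF that])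
  moreover have "analysis (vscale H b f) = vscale HH b (analysis f)" if "f \<in> elems H" for f b
    by (rule synthesis_inj[OF An[OF clH(2)[OF that that]] cl(2)[OF An[OF that] An[OF that]]])
       (simp only: lin(2)[OF An[OF that] An[OF that]] synthesis_analysis that clH(2)[OF that that])
  ultimately show ?thesis
    unfolding bounded_operator_def using analysis_bounded An by blast
qed

text \<open>Boundedness of \<open>mult_operator A\<close> comes without multiplier estimates: on H
  it equals analysis, followed by the shift on each copy, followed by synthesis. A agrees with B on
  the disk, which is all that functions vanishing outside can see.\<close>

lemma similar_mult_B:
  assumes A: "\<And>z. z \<in> ball 0 1 \<Longrightarrow> A z = B z"
  shows "similar_operators H (mult_operator A) HH (direct_sum_operator {1..m} (\<lambda>_. mult_operator (\<lambda>z. z)))"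
proof -
  let ?Z = "direct_sum_operator {1..m} (\<lambda>_. mult_operator (\<lambda>z. z))"
  have Z: "bounded_operator HH HH ?Z"
    by (rule bounded_operator_direct_sum[OF bounded_operator_mult_z[OF regular_weight_axioms]])
       (auto simp: elems_weighted_hardy vnorm_weighted_hardy weighted_norm_nonneg)
  have ZF: "?Z F \<in> elems HH" if "F \<in> elems HH" for F using Z that by (auto simp: bounded_operator_def)
  have An: "analysis f \<in> elems HH" if "f \<in> elems H" for f using analysis_bounded that by blast
  have Sy: "synthesis F \<in> elems H" if "F \<in> elems HH" for F
    using bounded_operator_synthesis that by (auto simp: bounded_operator_def)
  \<comment> \<open>Substituting B into z times \<open>F j\<close> produces the factor B; outside
    the disk both sides are 0.\<close>
  have inter: "synthesis (?Z F) = mult_operator A (synthesis F)" for F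
    by (rule ext) (simp add: synthesis_def direct_sum_operator_def mult_operator_def A sum_distrib_left mult.left_commute)
  have MA: "mult_operator A f = synthesis (?Z (analysis f))" if "f \<in> elems H" for f
    using inter[of "analysis f"] synthesis_analysis[OF that] by simp
  have nonneg: "0 \<le> vnorm HH F" for F by (simp add: vnorm_direct_sum)
  have "bounded_operator H H (synthesis \<circ> (?Z \<circ> analysis))"
    by (intro bounded_operator_compose[OF bounded_operator_compose[OF bounded_operator_analysis Z] bounded_operator_synthesis] nonneg)
  moreover have "vplus H f g \<in> elems H" "vscale H b f \<in> elems H" if "f \<in> elems H" "g \<in> elems H" for f g b
    using that unfolding vplus_weighted_hardy vscale_weighted_hardy
    by (auto intro: weighted_hardy_add weighted_hardy_scale)
  ultimately have M: "bounded_operator H H (mult_operator A)"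
    unfolding bounded_operator_def using MA by (simp add: Pi_iff)
  \<comment> \<open>\<open>analysis\<close> after \<open>synthesis\<close> is the identity by
    injectivity: applying \<open>synthesis\<close> once more reduces the claim to the right
    inverse.\<close>
  have inv: "bounded_invertible H HH analysis"
    unfolding bounded_invertible_def
    using bounded_operator_analysis bounded_operator_synthesis synthesis_analysis
      synthesis_inj[OF An[OF Sy]] Sy by metis
  have "analysis (mult_operator A f) = ?Z (analysis f)" if f: "f \<in> elems H" for f
    unfolding MA[OF f] by (rule synthesis_inj) (simp_all only: An Sy ZF f synthesis_analysis)
  thus ?thesis unfolding similar_operators_def using M Z inv by blast
qed

end

theorem theorem2p3:
  fixes w :: "nat \<Rightarrow> real" and m :: nat and B :: "complex \<Rightarrow> complex"
  assumes "weight_sequence w"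
    and "polynomial_growth w"
    and "finite_blaschke_product m B"
  shows "similar_operators
           (weighted_hardy w) (mult_operator B)
           (direct_sum {1..m} (\<lambda>_. weighted_hardy w))
           (direct_sum_operator {1..m} (\<lambda>_. mult_operator (\<lambda>z. z)))"
proof -
  interpret regular_weight "hardy_beta w" by (rule regular_weight_hardy_beta) fact+
  obtain \<theta> :: real and a where m: "m \<ge> 1" and a: "\<And>j. j \<in> {1..m} \<Longrightarrow> a j \<in> ball 0 1"
    and B: "\<And>z. z \<in> ball 0 1 \<Longrightarrow> B z = cis \<theta> * (\<Prod>j=1..m. (a j - z) / (1 - cnj (a j) * z))"
    using assms(3) unfolding finite_blaschke_product_def by blast
  interpret hardy_blaschke m a "cis \<theta>" w
    by unfold_locales (use m a in auto)
  show ?thesis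
    by (rule similar_mult_B) (simp add: B B_def blaschke_factor_def)
qed

end
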